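(* Consider the differential inclusion $$\dot x(t)\in -\nabla^2R_x(x(t))^{-1}\big(\partial_xL(x(t),\gamma(t))+\mathcal N_{\mathcal X}(x(t))\big),\qquad \dot\gamma(t)\in \nabla^2R_\gamma(\gamma(t))^{-1}\big(\partial_\gamma^+L(x(t),\gamma(t))-\mathcal N_{\mathcal Y}(\gamma(t))\big). \tag{N}$$ Every equilibrium point $(x^*,\gamma^* )\in\mathcal S$ of (N) is Lyapunov stable. Furthermore, every viable Caratheodory solution $(x(t),\gamma(t))$ of (N) with initial condition $(x_0,\gamma_0)\in\mathcal X\times\mathcal Y$ converges asymptotically to the set $\mathcal S$, i.e. $d\big((x(t),\gamma(t)),\mathcal S\big)\to0$ as $t\to\infty$.
   Context: Setting. $\mathcal X\subseteq\mathbb R^n$, $\mathcal Y\subseteq\mathbb R^m$ are nonempty, convex and compact. $L:\mathbb R^n\times\mathbb R^m\to[-\infty,+\infty]$ is convex in $x\in\mathbb R^n$ and concave in $\gamma\in\mathbb R^m$. For $(x,\gamma)\in\mathcal X\times\mathcal Y$, $\partial_xL(x,\gamma)=\{g\in\mathbb R^n: L(y,\gamma)\ge L(x,\gamma)+\langle g,y-x\rangle\ \forall y\in\mathbb R^n\}$ and $\partial_\gamma^+L(x,\gamma)=\{g\in\mathbb R^m: L(x,\delta)\le L(x,\gamma)+\langle g,\delta-\gamma\rangle\ \forall \delta\in\mathbb R^m\}$. A saddle point is $(x^*,\gamma^* )\in\mathcal X\times\mathcal Y$ with $L(x^*,\gamma)\le L(x^*,\gamma^* )\le L(x,\gamma^*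 )$ for all $x\in\mathcal X,\gamma\in\mathcal Y$; $\mathcal S$ is the set of saddle points. Standing assumptions. (A1) $\mathcal S$ is nonempty and compact, and for every $(x,\gamma)\in(\mathcal X\times\mathcal Y)\setminus\mathcal S$ there is $(x^*,\gamma^* )\in\mathcal S$ with $L(x^*,\gamma)<L(x^*,\gamma^* )$ or $L(x^*,\gamma^* )<L(x,\gamma^* )$. (A2) For each $x\in\mathcal X$, $L(x,\cdot)$ is upper semicontinuous on $\mathbb R^m$; for each $\gamma\in\mathcal Y$, $L(\cdot,\gamma)$ is lower semicontinuous on $\mathbb R^n$. (A3) For each $(x,\gamma)\in\mathcal X\times\mathcal Y$, $\partial_xL(x,\gamma)\times\partial_\gamma^+L(x,\gamma)$ is nonempty, and there is $G>0$ such that all elements of $\partial_xL(x,\gamma)$ and $\partial^+_\gamma L(x,\gamma)$, for all $(x,\gamma)\in\mathcal X\times\mathcal Y$, have norm at most $G$. $R_x$ (on $\mathbb R^n$) and $R_\gamma$ (on $\mathbb R^m$) are extended-real-valued functions, twice continuously differentiable and $\sigma_R$-strongly convex ($\sigma_R>0$) on open sets containing $\mathcal X$ and $\mathcal Y$ respectively. Tangent and normal cones of a closed convex set $\mathcal C$ at $x\in \mathcal C$: $\mathcal T_{\mathcal C}(x)=\{v: v=\lim_k (x_k-x)/t_k,\ x_k\in\mathcal C,\ t_k\downarrow0\}$ and $\mathcal N_{\mathcal C}(x)=\{\eta:\langle\eta,v\rangle\le0\ \forall v\in\mathcal T_{\mathcal C}(x)\}$. A viable Caratheodory solution is an absolutely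 continuous map $(x,\gamma):[0,\infty)\to\mathcal X\times\mathcal Y$ satisfying the initial condition and satisfying the inclusion for almost every $t$. An equilibrium point is a point at which $0$ belongs to the right-hand side; the equilibrium points of (N) are exactly the elements of $\mathcal S$. An equilibrium $z_e$ is Lyapunov stable if for every $\epsilon>0$ there is $\delta>0$ such that every viable Caratheodory solution $z(t)$ with $z(0)\in\mathcal X\times\mathcal Y$, $\|z(0)-z_e\|<\delta$, satisfies $\|z(t)-z_e\|<\epsilon$ for all $t\ge0$. $d(z,\mathcal A)=\inf_{a\in\mathcal A}\|a-z\|$. *)

theory Defs
  imports "HOL-Analysis.Analysis"
begin

section \<open>Extended-real-valued convex functions\<close>

text \<open>For functions with values in \<open>[-\<infinity>, +\<infinity>]\<close> convexity means convexity of the epigraph, which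
  avoids the undefined sum \<open>\<infinity> - \<infinity>\<close> in Jensen's inequality.\<close>

definition ext_convex :: "('a::real_vector \<Rightarrow> ereal) \<Rightarrow> bool" where
  "ext_convex f \<longleftrightarrow> convex {(x, r::real). f x \<le> ereal r}"

definition ext_concave :: "('a::real_vector \<Rightarrow> ereal) \<Rightarrow> bool" where
  "ext_concave f \<longleftrightarrow> ext_convex (\<lambda>x. - f x)"

definition lower_semicontinuous :: "('a::topological_space \<Rightarrow> ereal) \<Rightarrow> bool" where
  "lower_semicontinuous f \<longleftrightarrow> (\<forall>x. f x \<le> Liminf (at x) f)"

definition upper_semicontinuous :: "('a::topological_space \<Rightarrow> ereal) \<Rightarrow> bool" where
  "upper_semicontinuous f \<longleftrightarrow> (\<forall>x. Limsup (at x) f \<le> f x)"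

definition subdifferential :: "('a::real_inner \<Rightarrow> ereal) \<Rightarrow> 'a \<Rightarrow> 'a set" where
  "subdifferential f x = {g. \<forall>y. f y \<ge> f x + ereal (g \<bullet> (y - x))}"

definition superdifferential :: "('a::real_inner \<Rightarrow> ereal) \<Rightarrow> 'a \<Rightarrow> 'a set" where
  "superdifferential f x = {g. \<forall>y. f y \<le> f x + ereal (g \<bullet> (y - x))}"

definition saddle_points :: "'a set \<Rightarrow> 'b set \<Rightarrow> ('a \<Rightarrow> 'b \<Rightarrow> ereal) \<Rightarrow> ('a \<times> 'b) set" where
  "saddle_points X Y L =
    {(x0, y0). x0 \<in> X \<and> y0 \<in> Y \<and> (\<forall>x\<in>X. \<forall>y\<in>Y. L x0 y \<le> L x0 y0 \<and> L x0 y0 \<le> L x y0)}"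


section \<open>Smooth strongly convex functions\<close>

definition gradient :: "('a::real_inner \<Rightarrow> real) \<Rightarrow> 'a \<Rightarrow> 'a" where
  "gradient f x = (THE D. GDERIV f x :> D)"

lemma gradient_eqI:
  assumes "GDERIV f x :> D"
  shows "gradient f x = D"
  unfolding gradient_def
proof (rule the_equality)
  fix D' assume "GDERIV f x :> D'"
  with assms have "(\<lambda>h. h \<bullet> D') = (\<lambda>h. h \<bullet> D)"
    unfolding gderiv_def by (blast dest: has_derivative_unique)
  then have "\<forall>h. h \<bullet> D' = h \<bullet> D"
    by (simp add: fun_eq_iff)
  then show "D' = D"
    by (simp only: vector_eq_ldot)
qed (fact assms)

definition hessian :: "(real^'n \<Rightarrow> real) \<Rightarrow> real^'n \<Rightarrow> real^'n^'n" where
  "hessian f x = jacobian (gradient f) (at x)"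

definition C2_on :: "(real^'n) set \<Rightarrow> (real^'n \<Rightarrow> real) \<Rightarrow> bool" where
  "C2_on U f \<longleftrightarrow> open U \<and> (\<forall>x\<in>U. f differentiable (at x)) \<and>
     (\<forall>x\<in>U. gradient f differentiable (at x)) \<and> continuous_on U (hessian f)"

text \<open>An extended-real-valued function is \<open>C\<^sup>2\<close> on an open set if it is finite there and its real
  part is \<open>C\<^sup>2\<close> there.\<close>

definition ext_C2_on :: "(real^'n) set \<Rightarrow> (real^'n \<Rightarrow> ereal) \<Rightarrow> bool" where
  "ext_C2_on U R \<longleftrightarrow> (\<forall>x\<in>U. \<bar>R x\<bar> \<noteq> \<infinity>) \<and> C2_on U (\<lambda>x. real_of_ereal (R x))"

text \<open>The set \<open>U\<close> is not required to be convex: outside \<open>U\<close> the left-hand side is an arbitrary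
  extended real.\<close>

definition ext_strongly_convex_on ::
    "('a::real_inner) set \<Rightarrow> real \<Rightarrow> ('a \<Rightarrow> ereal) \<Rightarrow> bool" where
  "ext_strongly_convex_on U \<sigma> R \<longleftrightarrow>
    (\<forall>x\<in>U. \<forall>y\<in>U. \<forall>t\<in>{0..1::real}.
       R ((1 - t) *\<^sub>R x + t *\<^sub>R y)
         \<le> ereal (1 - t) * R x + ereal t * R y - ereal (\<sigma> / 2 * t * (1 - t) * (norm (x - y))\<^sup>2))"


section \<open>Tangent and normal cones\<close>

definition tangent_cone :: "('a::real_inner) set \<Rightarrow> 'a \<Rightarrow> 'a set" where
  "tangent_cone C x =
    {v. \<exists>(u :: nat \<Rightarrow> 'a) (t :: nat \<Rightarrow> real).
        (\<forall>k. u k \<in> C) \<and> (\<forall>k. t k > 0) \<and> decseq t \<and> t \<longlonglongrightarrow> 0 \<and>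
        (\<lambda>k. (u k - x) /\<^sub>R t k) \<longlonglongrightarrow> v}"

definition normal_cone :: "('a::real_inner) set \<Rightarrow> 'a \<Rightarrow> 'a set" where
  "normal_cone C x = {\<eta>. \<forall>v\<in>tangent_cone C x. \<eta> \<bullet> v \<le> 0}"


section \<open>Differential inclusions\<close>

definition abs_continuous_on :: "real set \<Rightarrow> (real \<Rightarrow> 'a::metric_space) \<Rightarrow> bool" where
  "abs_continuous_on S f \<longleftrightarrow>
    (\<forall>\<epsilon>>0. \<exists>\<delta>>0. \<forall>(n::nat) (a :: nat \<Rightarrow> real) b.
       (\<forall>i<n. a i \<le> b i \<and> {a i..b i} \<subseteq> S) \<and>
       disjoint_family_on (\<lambda>i. {a i<..<b i}) {..<n} \<and> (\<Sum>i<n. b i - a i) < \<delta>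
       \<longrightarrow> (\<Sum>i<n. dist (f (a i)) (f (b i))) < \<epsilon>)"

text \<open>Solutions of \<open>z' \<in> F z\<close>, \<open>z 0 = z0\<close> that stay in \<open>C\<close>. Absolute continuity on the unbounded
  interval \<open>[0,\<infinity>)\<close> is understood on every compact subinterval. The values of \<open>z\<close> at negative
  times are irrelevant.\<close>

definition viable_caratheodory_solution ::
    "('a::euclidean_space \<Rightarrow> 'a set) \<Rightarrow> 'a set \<Rightarrow> 'a \<Rightarrow> (real \<Rightarrow> 'a) \<Rightarrow> bool" where
  "viable_caratheodory_solution F C z0 z \<longleftrightarrow>
     (\<forall>t\<ge>0. z t \<in> C) \<and> z 0 = z0 \<and>
     (\<forall>T\<ge>0. abs_continuous_on {0..T} z) \<and>
     (AE t in lebesgue. t \<ge> 0 \<longrightarrow>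
        (\<exists>v\<in>F (z t). (z has_vector_derivative v) (at t within {0..})))"

definition equilibrium_point :: "('a::euclidean_space \<Rightarrow> 'a set) \<Rightarrow> 'a set \<Rightarrow> 'a \<Rightarrow> bool" where
  "equilibrium_point F C ze \<longleftrightarrow> ze \<in> C \<and> 0 \<in> F ze"

definition lyapunov_stable_equilibrium ::
    "('a::euclidean_space \<Rightarrow> 'a set) \<Rightarrow> 'a set \<Rightarrow> 'a \<Rightarrow> bool" where
  "lyapunov_stable_equilibrium F C ze \<longleftrightarrow> equilibrium_point F C ze \<and>
     (\<forall>\<epsilon>>0. \<exists>\<delta>>0. \<forall>z0\<in>C. \<forall>z. viable_caratheodory_solution F C z0 z \<and> norm (z0 - ze) < \<delta>
        \<longrightarrow> (\<forall>t\<ge>0. norm (z t - ze) < \<epsilon>))"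

definition natural_gradient_rhs ::
    "(real^'n) set \<Rightarrow> (real^'m) set \<Rightarrow> (real^'n \<Rightarrow> real^'m \<Rightarrow> ereal) \<Rightarrow>
     (real^'n \<Rightarrow> ereal) \<Rightarrow> (real^'m \<Rightarrow> ereal) \<Rightarrow>
     (real^'n) \<times> (real^'m) \<Rightarrow> ((real^'n) \<times> (real^'m)) set" where
  "natural_gradient_rhs X Y L Rx R\<gamma> = (\<lambda>(x, \<gamma>).
     {- (matrix_inv (hessian (\<lambda>x. real_of_ereal (Rx x)) x) *v (g + \<eta>)) | g \<eta>.
        g \<in> subdifferential (\<lambda>y. L y \<gamma>) x \<and> \<eta> \<in> normal_cone X x}
     \<times>
     {matrix_inv (hessian (\<lambda>\<gamma>. real_of_ereal (R\<gamma> \<gamma>)) \<gamma>) *v (g - \<eta>) | g \<eta>.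
        g \<in> superdifferential (L x) \<gamma> \<and> \<eta> \<in> normal_cone Y \<gamma>})"

end

theory Submission
  imports Defs
begin

text \<open>
  The Lyapunov functions are Bregman divergences. For a saddle point \<open>s = (p, q)\<close> let
  \<open>V\<^sub>s (x, y) = D (p, x) + D (q, y)\<close>, where \<open>D\<close> is the Bregman divergence of the respective mirror map.
  The Hessian in the derivative of \<open>D (p, \<cdot>)\<close> cancels the inverse Hessian in the flow, so along a
  solution what remains is \<open>(g + \<eta>) \<bullet> (p - x)\<close> with a subgradient \<open>g\<close> and a normal \<open>\<eta>\<close>. The normal
  contributes something nonpositive and \<open>g\<close> at most \<open>L p y - L x y\<close>; adding the symmetric estimate
  for the other player gives almost everywhere
  \<open>d/dt V\<^sub>s \<le> L p y - L x q \<le> 0\<close> (\<open>lyapunov_derivative_le_gap\<close>). Since \<open>V\<^sub>s\<close> is bounded below by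
  a multiple of the squared distance to \<open>s\<close> and vanishes at \<open>s\<close>, every saddle point is
  Lyapunov stable. That \<open>0\<close> lies in the right-hand side at a saddle point is the first-order
  optimality condition for each player, which holds because the subdifferentials are nonempty and
  bounded (\<open>constrained_minimum_imp_subgradient_normal\<close>).

  For convergence, call \<open>L p y - L x q\<close> the gap. It is continuous on the compact set \<open>X \<times> Y\<close>, and
  at a point that is not a saddle point the gap for some saddle point is strictly negative, by
  the strictness assumption on the saddle function. The normal cone makes the right-hand side unbounded, but the velocity of a solution
  is almost everywhere a two-sided derivative, so both it and its negative are tangent and
  the normal component is orthogonal to it; coercivity of the Hessian then bounds the speed, and
  solutions are Lipschitz (\<open>solution_lipschitz\<close>). If a solution came back infinitely often
  near a point that is not a saddle point, it would spend a fixed amount of time there in each late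
  visit, and some \<open>V\<^sub>s\<close> would lose a fixed amount each time; but \<open>V\<^sub>s\<close> is nonincreasing and
  nonnegative (\<open>dissipation_imp_convergence\<close>).

  Both uses of an almost everywhere derivative rest on one fact about absolutely continuous
  functions: a derivative that is at most \<open>c\<close> almost everywhere bounds the increment by \<open>c\<close> times the
  length (\<open>abs_continuous_increment_le\<close>). It is obtained from Cousin's lemma, without integration.
\<close>

section \<open>Absolutely continuous functions\<close>

lemma abs_continuous_onE:
  assumes "abs_continuous_on S f" and "\<epsilon> > 0"
  obtains \<delta> where "\<delta> > 0" and "\<forall>(n::nat) (a :: nat \<Rightarrow> real) b.
       (\<forall>i<n. a i \<le> b i \<and> {a i..b i} \<subseteq> S) \<and>
       disjoint_family_on (\<lambda>i. {a i<..<b i}) {..<n} \<and> (\<Sum>i<n. b i - a i) < \<delta>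
       \<longrightarrow> (\<Sum>i<n. dist (f (a i)) (f (b i))) < \<epsilon>"
  using assms(1)[unfolded abs_continuous_on_def, THEN spec, THEN mp, OF assms(2)] by (elim exE conjE)

lemma abs_continuous_on_subset:
  assumes "abs_continuous_on S f" and "T \<subseteq> S"
  shows "abs_continuous_on T f"
  unfolding abs_continuous_on_def
proof (intro allI impI)
  fix \<epsilon> :: real assume "\<epsilon> > 0"
  then obtain \<delta> where "\<delta> > 0" and \<delta>: "\<forall>(n::nat) (a :: nat \<Rightarrow> real) b.
       (\<forall>i<n. a i \<le> b i \<and> {a i..b i} \<subseteq> S) \<and>
       disjoint_family_on (\<lambda>i. {a i<..<b i}) {..<n} \<and> (\<Sum>i<n. b i - a i) < \<delta>
       \<longrightarrow> (\<Sum>i<n. dist (f (a i)) (f (b i))) < \<epsilon>"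
    by (rule abs_continuous_onE[OF assms(1)])
  show "\<exists>\<delta>>0. \<forall>(n::nat) (a :: nat \<Rightarrow> real) b.
       (\<forall>i<n. a i \<le> b i \<and> {a i..b i} \<subseteq> T) \<and>
       disjoint_family_on (\<lambda>i. {a i<..<b i}) {..<n} \<and> (\<Sum>i<n. b i - a i) < \<delta>
       \<longrightarrow> (\<Sum>i<n. dist (f (a i)) (f (b i))) < \<epsilon>"
  proof (intro exI[of _ \<delta>] conjI allI impI \<open>\<delta> > 0\<close>)
    fix n :: nat and a b :: "nat \<Rightarrow> real"
    assume *: "(\<forall>i<n. a i \<le> b i \<and> {a i..b i} \<subseteq> T) \<and>
       disjoint_family_on (\<lambda>i. {a i<..<b i}) {..<n} \<and> (\<Sum>i<n. b i - a i) < \<delta>"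
    then have "\<forall>i<n. a i \<le> b i \<and> {a i..b i} \<subseteq> S"
      using \<open>T \<subseteq> S\<close> by (meson order_trans)
    with * show "(\<Sum>i<n. dist (f (a i)) (f (b i))) < \<epsilon>"
      by (intro \<delta>[rule_format]) auto
  qed
qed

lemma abs_continuous_on_lipschitz_compose:
  assumes f: "abs_continuous_on S f" and g: "C-lipschitz_on U g" and fU: "f ` S \<subseteq> U"
  shows "abs_continuous_on S (\<lambda>t. g (f t))"
  unfolding abs_continuous_on_def
proof (intro allI impI)
  fix \<epsilon> :: real assume "\<epsilon> > 0"
  have C: "C \<ge> 0" using g by (rule lipschitz_on_nonneg)
  then have "\<epsilon> / (C + 1) > 0" using \<open>\<epsilon> > 0\<close> by simp
  then obtain \<delta> where "\<delta> > 0" and \<delta>: "\<forall>(n::nat) (a :: nat \<Rightarrow> real) b.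
       (\<forall>i<n. a i \<le> b i \<and> {a i..b i} \<subseteq> S) \<and>
       disjoint_family_on (\<lambda>i. {a i<..<b i}) {..<n} \<and> (\<Sum>i<n. b i - a i) < \<delta>
       \<longrightarrow> (\<Sum>i<n. dist (f (a i)) (f (b i))) < \<epsilon> / (C + 1)"
    by (rule abs_continuous_onE[OF f])
  show "\<exists>\<delta>>0. \<forall>(n::nat) (a :: nat \<Rightarrow> real) b.
       (\<forall>i<n. a i \<le> b i \<and> {a i..b i} \<subseteq> S) \<and>
       disjoint_family_on (\<lambda>i. {a i<..<b i}) {..<n} \<and> (\<Sum>i<n. b i - a i) < \<delta>
       \<longrightarrow> (\<Sum>i<n. dist (g (f (a i))) (g (f (b i)))) < \<epsilon>"
  proof (intro exI[of _ \<delta>] conjI allI impI \<open>\<delta> > 0\<close>)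
    fix n :: nat and a b :: "nat \<Rightarrow> real"
    assume *: "(\<forall>i<n. a i \<le> b i \<and> {a i..b i} \<subseteq> S) \<and>
       disjoint_family_on (\<lambda>i. {a i<..<b i}) {..<n} \<and> (\<Sum>i<n. b i - a i) < \<delta>"
    have "(\<Sum>i<n. dist (g (f (a i))) (g (f (b i)))) \<le> (\<Sum>i<n. C * dist (f (a i)) (f (b i)))"
    proof (rule sum_mono)
      fix i assume "i \<in> {..<n}"
      with * have "a i \<le> b i" "{a i..b i} \<subseteq> S" by auto
      then have "a i \<in> S" "b i \<in> S" by auto
      then show "dist (g (f (a i))) (g (f (b i))) \<le> C * dist (f (a i)) (f (b i))"
        using fU by (intro lipschitz_onD[OF g]) auto
    qed
    also have "\<dots> = C * (\<Sum>i<n. dist (f (a i)) (f (b i)))"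
      by (simp add: sum_distrib_left)
    also have "\<dots> \<le> (C + 1) * (\<Sum>i<n. dist (f (a i)) (f (b i)))"
      by (intro mult_right_mono sum_nonneg) auto
    also have "\<dots> < (C + 1) * (\<epsilon> / (C + 1))"
      using * C by (intro mult_strict_left_mono \<delta>[rule_format]) auto
    also have "\<dots> = \<epsilon>" using C by simp
    finally show "(\<Sum>i<n. dist (g (f (a i))) (g (f (b i)))) < \<epsilon>" .
  qed
qed

text \<open>Absolute continuity in the vocabulary of gauges: the disjoint open intervals of the definition
  are the interiors of the cells of a tagged partial division.\<close>

lemma abs_continuous_on_tagged_division:
  assumes f: "abs_continuous_on {a..b} f" and "\<epsilon> > 0"
  obtains \<delta> where "\<delta> > 0" and "\<forall>q. q tagged_partial_division_of {a..b} \<and>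
      (\<Sum>(t, K)\<in>q. measure lborel K) < \<delta> \<longrightarrow>
      (\<Sum>(t, K)\<in>q. dist (f (Inf K)) (f (Sup K))) < \<epsilon>"
proof -
  obtain \<delta> where "\<delta> > 0" and \<delta>: "\<forall>(n::nat) (c :: nat \<Rightarrow> real) d.
       (\<forall>i<n. c i \<le> d i \<and> {c i..d i} \<subseteq> {a..b}) \<and>
       disjoint_family_on (\<lambda>i. {c i<..<d i}) {..<n} \<and> (\<Sum>i<n. d i - c i) < \<delta>
       \<longrightarrow> (\<Sum>i<n. dist (f (c i)) (f (d i))) < \<epsilon>"
    by (rule abs_continuous_onE[OF assms])
  show thesis
  proof (rule that[OF \<open>\<delta> > 0\<close>], intro allI impI, elim conjE)
    fix q :: "(real \<times> real set) set"
    assume q: "q tagged_partial_division_of {a..b}"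
      and small: "(\<Sum>(t, K)\<in>q. measure lborel K) < \<delta>"
    note qD = tagged_partial_division_ofD[OF q]
    have K: "snd k = {Inf (snd k)..Sup (snd k)}" "Inf (snd k) \<le> Sup (snd k)"
      "snd k \<subseteq> {a..b}" "measure lborel (snd k) = Sup (snd k) - Inf (snd k)" if "k \<in> q" for k
    proof -
      obtain t K where k: "k = (t, K)" by (cases k)
      with that qD(2,4) obtain u v where uv: "K = {u..v}" "t \<in> K" by (metis box_real(2))
      then have "u \<le> v" by auto
      then show "snd k = {Inf (snd k)..Sup (snd k)}" "Inf (snd k) \<le> Sup (snd k)"
        "measure lborel (snd k) = Sup (snd k) - Inf (snd k)"
        by (simp_all add: k uv)
      show "snd k \<subseteq> {a..b}" using that qD(3) k by auto
    qed
    obtain h where h: "bij_betw h {..<card q} q"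
      using ex_bij_betw_nat_finite[OF qD(1)] by (auto simp: atLeast0LessThan)
    then have hq: "h i \<in> q" if "i < card q" for i
      using that by (auto simp: bij_betw_def)
    let ?c = "\<lambda>i. Inf (snd (h i))" and ?d = "\<lambda>i. Sup (snd (h i))"
    have "(\<Sum>i<card q. dist (f (?c i)) (f (?d i))) < \<epsilon>"
    proof (rule \<delta>[rule_format], intro conjI allI impI)
      show "?c i \<le> ?d i" "{?c i..?d i} \<subseteq> {a..b}" if "i < card q" for i
        using K[OF hq[OF that]] by simp_all
      show "disjoint_family_on (\<lambda>i. {?c i<..<?d i}) {..<card q}"
        unfolding disjoint_family_on_def
      proof (intro ballI impI)
        fix i j assume ij: "i \<in> {..<card q}" "j \<in> {..<card q}" "i \<noteq> j"
        then have "h i \<noteq> h j"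
          using h by (auto simp: bij_betw_def inj_on_def)
        then have "interior (snd (h i)) \<inter> interior (snd (h j)) = {}"
          using qD(5)[of "fst (h i)" "snd (h i)" "fst (h j)" "snd (h j)"] hq ij by auto
        then show "{?c i<..<?d i} \<inter> {?c j<..<?d j} = {}"
          using K(1)[OF hq, of i] K(1)[OF hq, of j] ij
          by (metis interior_atLeastAtMost_real lessThan_iff)
      qed
      have "(\<Sum>i<card q. ?d i - ?c i) = (\<Sum>i<card q. (\<lambda>(t,K). measure lborel K) (h i))"
        by (rule sum.cong) (use K(4) hq in \<open>auto simp: split_beta\<close>)
      also have "\<dots> = (\<Sum>(t, K)\<in>q. measure lborel K)"
        by (rule sum.reindex_bij_betw[OF h])
      finally show "(\<Sum>i<card q. ?d i - ?c i) < \<delta>" using small by simp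
    qed
    also have "(\<Sum>i<card q. dist (f (?c i)) (f (?d i))) =
        (\<Sum>i<card q. (\<lambda>(t,K). dist (f (Inf K)) (f (Sup K))) (h i))"
      by (rule sum.cong) (auto simp: split_beta)
    also have "\<dots> = (\<Sum>(t, K)\<in>q. dist (f (Inf K)) (f (Sup K)))"
      by (rule sum.reindex_bij_betw[OF h])
    finally show "(\<Sum>(t, K)\<in>q. dist (f (Inf K)) (f (Sup K))) < \<epsilon>" .
  qed
qed

text \<open>Cells overlap only in their endpoints, so passing to interiors turns the sum into the measure of
  a disjoint union.\<close>

lemma sum_content_tagged_partial_division_le:
  assumes q: "(q :: (real \<times> real set) set) tagged_partial_division_of {a..b}"
    and W: "\<And>t K. (t, K) \<in> q \<Longrightarrow> K \<subseteq> W" "W \<in> lmeasurable"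
  shows "(\<Sum>(t, K)\<in>q. measure lborel K) \<le> measure lebesgue W"
proof -
  note qD = tagged_partial_division_ofD[OF q]
  have "(\<Sum>(t, K)\<in>q. measure lborel K) = sum (\<lambda>k. measure lebesgue (interior (snd k))) q"
  proof (rule sum.cong[OF refl], clarify)
    fix t K assume "(t, K) \<in> q"
    then obtain u v where uv: "K = {u..v}" "t \<in> K" using qD(2,4) by (metis box_real(2))
    then have "u \<le> v" by auto
    then show "measure lborel K = measure lebesgue (interior (snd (t, K)))"
      by (simp add: uv)
  qed
  also have "\<dots> = measure lebesgue (\<Union>k\<in>q. interior (snd k))"
  proof (rule measure_finite_Union[symmetric, OF qD(1)])
    show "(\<lambda>k. interior (snd k)) ` q \<subseteq> sets lebesgue"
      by auto
    show "disjoint_family_on (\<lambda>k. interior (snd k)) q"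
      using qD(5) by (fastforce simp: disjoint_family_on_def)
    show "emeasure lebesgue (interior (snd k)) \<noteq> \<infinity>" if "k \<in> q" for k
    proof -
      have "bounded (snd k)" using that qD(4)[of "fst k" "snd k"] by (auto)
      then have "interior (snd k) \<in> lmeasurable"
        by (intro bounded_set_imp_lmeasurable bounded_interior) auto
      then show ?thesis by (metis fmeasurableD2 infinity_ennreal_def)
    qed
  qed
  also have "\<dots> \<le> measure lebesgue W"
  proof (rule measure_mono_fmeasurable)
    show "(\<Union>k\<in>q. interior (snd k)) \<subseteq> W"
      using W(1) interior_subset by fastforce
    show "(\<Union>k\<in>q. interior (snd k)) \<in> sets lebesgue"
      by (intro sets.finite_UN qD(1)) auto
  qed (use W(2) in auto)
  finally show ?thesis .
qed

text \<open>By Cousin's lemma a gauge has a fine tagged division. At a tag outside \<open>N\<close> the gauge is chosen so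
  that the increment over the cell is at most \<open>c + e\<close> times its length; at a tag in \<open>N\<close> it keeps the
  cell inside an open set \<open>W \<supseteq> N\<close> of small measure, and absolute continuity makes the increments
  over all these cells together smaller than \<open>e\<close>.\<close>

lemma abs_continuous_increment_le:
  fixes f :: "real \<Rightarrow> real"
  assumes ab: "a \<le> b" and f: "abs_continuous_on {a..b} f" and N: "negligible N"
    and deriv: "\<And>t. t \<in> {a..b} - N \<Longrightarrow>
      \<exists>D\<le>c. (f has_vector_derivative D) (at t within {a..b})"
  shows "f b - f a \<le> c * (b - a)"
proof -
  have approx: "f b - f a \<le> c * (b - a) + e * (b - a + 2)" if e: "e > 0" for e
  proof -
    obtain \<delta> where "\<delta> > 0" and \<delta>: "\<forall>q. q tagged_partial_division_of {a..b} \<and>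
      (\<Sum>(t, K)\<in>q. measure lborel K) < \<delta> \<longrightarrow>
      (\<Sum>(t, K)\<in>q. dist (f (Inf K)) (f (Sup K))) < e"
      by (rule abs_continuous_on_tagged_division[OF f e])
    \<comment> \<open>Measure below \<open>\<delta>\<close> is for absolute continuity; below \<open>e / (\<bar>c\<bar> + 1)\<close> it makes omitting the cells tagged in \<open>N\<close> change \<open>c\<close> times the total length by less than \<open>e\<close>.\<close>
    define \<eta> where "\<eta> = min \<delta> (e / (\<bar>c\<bar> + 1))"
    have "\<eta> > 0" using \<open>\<delta> > 0\<close> e by (simp add: \<eta>_def)
    obtain W where W: "open W" "N \<subseteq> W" "W \<in> lmeasurable" "measure lebesgue W < \<eta>"
    proof -
      have Nl: "N \<in> lmeasurable" "measure lebesgue N = 0"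
        using N by (auto simp: negligible_iff_measure)
      obtain W where W: "open W" "N \<subseteq> W" "W - N \<in> lmeasurable"
          "emeasure lebesgue (W - N) < ennreal \<eta>"
        using sets_lebesgue_outer_open[OF fmeasurableD[OF Nl(1)] \<open>\<eta> > 0\<close>] by blast
      have "W = N \<union> (W - N)" using W(2) by auto
      then have "W \<in> lmeasurable" using Nl(1) W(3) by (metis fmeasurable.Un)
      moreover have "measure lebesgue W \<le> measure lebesgue N + measure lebesgue (W - N)"
        using \<open>W = N \<union> (W - N)\<close> Nl(1) W(3) by (metis fmeasurableD measure_Un_le)
      moreover have "measure lebesgue (W - N) < \<eta>"
        using W(3,4) \<open>\<eta> > 0\<close> by (simp add: emeasure_eq_measure2 ennreal_less_iff)
      ultimately show thesis using W(1,2) Nl(2) that by auto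
    qed
    have "\<exists>d>0. t \<in> {a..b} - N \<longrightarrow> (\<exists>D\<le>c. \<forall>s\<in>{a..b}. \<bar>s - t\<bar> < d \<longrightarrow>
        \<bar>f s - f t - (s - t) * D\<bar> \<le> e * \<bar>s - t\<bar>)" for t
    proof (cases "t \<in> {a..b} - N")
      case True
      from deriv[OF this] obtain D where "D \<le> c"
        and D: "(f has_vector_derivative D) (at t within {a..b})" by blast
      from D e obtain d where "d > 0"
        "\<And>s. s \<in> {a..b} \<Longrightarrow> norm (s - t) < d \<Longrightarrow>
          norm (f s - f t - (s - t) *\<^sub>R D) \<le> e * norm (s - t)"
        unfolding has_vector_derivative_def has_derivative_within_alt by blast
      with \<open>D \<le> c\<close> show ?thesis by (intro exI[of _ d]) auto
    qed (intro exI[of _ 1], auto)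
    then obtain d where d0: "\<And>t. d t > 0" and d: "\<And>t. t \<in> {a..b} - N \<Longrightarrow>
        (\<exists>D\<le>c. \<forall>s\<in>{a..b}. \<bar>s - t\<bar> < d t \<longrightarrow> \<bar>f s - f t - (s - t) * D\<bar> \<le> e * \<bar>s - t\<bar>)"
      by metis
    define \<gamma> where "\<gamma> t = (if t \<in> N then W else ball t (d t))" for t
    have "gauge \<gamma>" using W(1,2) d0 by (auto simp: gauge_def \<gamma>_def)
    then obtain p where p: "p tagged_division_of {a..b}" "\<gamma> fine p"
      using fine_division_exists_real by blast
    note pD = tagged_division_ofD[OF p(1)]
    define q where "q = {k\<in>p. fst k \<in> N}"
    have q: "q tagged_partial_division_of {a..b}" "finite q" "q \<subseteq> p"
      using p(1) pD(1) tagged_partial_division_subset[of p "{a..b}" q]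
      by (auto simp: q_def tagged_division_of_def)
    have len_q: "(\<Sum>(t, K)\<in>q. measure lborel K) \<le> measure lebesgue W"
    proof (rule sum_content_tagged_partial_division_le[OF q(1) _ W(3)])
      fix t K assume "(t, K) \<in> q"
      then show "K \<subseteq> W"
        using fineD[OF p(2), of t K] by (auto simp: q_def \<gamma>_def)
    qed
    then have "(\<Sum>(t, K)\<in>q. dist (f (Inf K)) (f (Sup K))) < e"
      using W(4) by (intro \<delta>[rule_format] conjI q) (auto simp: \<eta>_def)
    moreover have "(\<Sum>(t, K)\<in>q. f (Sup K) - f (Inf K)) \<le>
        (\<Sum>(t, K)\<in>q. dist (f (Inf K)) (f (Sup K)))"
      by (rule sum_mono) (auto simp: dist_real_def)
    ultimately have sum_q: "(\<Sum>(t, K)\<in>q. f (Sup K) - f (Inf K)) \<le> e" by linarith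
    have len: "(\<Sum>(t, K)\<in>p. Sup K - Inf K) = b - a"
      using additive_tagged_division_1[OF ab p(1), of "\<lambda>x. x"] by simp
    have K: "\<exists>u v. K = {u..v} \<and> u \<le> t \<and> t \<le> v \<and> a \<le> u \<and> v \<le> b" if tK: "(t, K) \<in> p" for t K
    proof -
      obtain u v where uv: "K = {u..v}" "t \<in> K"
        using pD(2)[OF tK] pD(4)[OF tK] by (auto simp: cbox_interval)
      then have "u \<in> K" "v \<in> K" by auto
      then show ?thesis using pD(3)[OF tK] uv by (intro exI[of _ u] exI[of _ v]) auto
    qed
    have sum_pq: "(\<Sum>(t, K)\<in>p - q. f (Sup K) - f (Inf K)) \<le> (\<Sum>(t, K)\<in>p - q. (c + e) * (Sup K - Inf K))"
    proof (rule sum_mono, clarify)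
      fix t K assume tK: "(t, K) \<in> p" "(t, K) \<notin> q"
      then have t: "t \<in> {a..b} - N" using K[OF tK(1)] tK by (auto simp: q_def)
      from K[OF tK(1)] obtain u v where uv: "K = {u..v}" "u \<le> t" "t \<le> v" "a \<le> u" "v \<le> b"
        by blast
      have Kball: "K \<subseteq> ball t (d t)"
        using fineD[OF p(2) tK(1)] t by (simp add: \<gamma>_def)
      from d[OF t] obtain D where "D \<le> c"
        and D: "\<And>s. s \<in> {a..b} \<Longrightarrow> \<bar>s - t\<bar> < d t \<Longrightarrow> \<bar>f s - f t - (s - t) * D\<bar> \<le> e * \<bar>s - t\<bar>"
        by blast
      have "u \<in> K" "v \<in> K" using uv by auto
      then have "u \<in> ball t (d t)" "v \<in> ball t (d t)" using Kball by blast+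
      then have "\<bar>u - t\<bar> < d t" "\<bar>v - t\<bar> < d t"
        by (auto simp: dist_real_def abs_minus_commute)
      then have "\<bar>f u - f t - (u - t) * D\<bar> \<le> e * \<bar>u - t\<bar>" "\<bar>f v - f t - (v - t) * D\<bar> \<le> e * \<bar>v - t\<bar>"
        by (intro D; use uv in simp)+
      then have "f v - f u \<le> (v - u) * D + e * (v - u)"
        using uv(2,3) by (auto simp: algebra_simps abs_le_iff)
      also have "\<dots> \<le> (c + e) * (v - u)"
        using \<open>D \<le> c\<close> uv(2,3) mult_left_mono[of D c "v - u"] by (auto simp: algebra_simps)
      finally show "f (Sup K) - f (Inf K) \<le> (c + e) * (Sup K - Inf K)"
        using uv by simp
    qed
    define l where "l = (\<Sum>(t, K)\<in>q. Sup K - Inf K)"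
    have "l = (\<Sum>(t, K)\<in>q. measure lborel K)"
      unfolding l_def
    proof (rule sum.cong[OF refl], clarify)
      fix t K assume "(t, K) \<in> q"
      then obtain u v where "K = {u..v}" "u \<le> v" using K q(3) by (meson order_trans subsetD)
      then show "Sup K - Inf K = measure lborel K" by simp
    qed
    with len_q W(4) have "l < e / (\<bar>c\<bar> + 1)" by (simp add: \<eta>_def)
    then have "\<bar>c\<bar> * l + l < e" by (simp add: pos_less_divide_eq algebra_simps)
    moreover have "l \<ge> 0"
      unfolding l_def
    proof (rule sum_nonneg, clarify)
      fix t K assume "(t, K) \<in> q"
      then obtain u v where "K = {u..v}" "u \<le> v" using K q(3) by (meson order_trans subsetD)
      then show "0 \<le> Sup K - Inf K" by simp
    qed
    moreover have "- c * l \<le> \<bar>c\<bar> * l"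
      using \<open>l \<ge> 0\<close> by (intro mult_right_mono) auto
    moreover have "e * l \<ge> 0" using e \<open>l \<ge> 0\<close> by simp
    ultimately have "(c + e) * (b - a - l) \<le> (c + e) * (b - a) + e"
      by (simp add: algebra_simps)
    moreover have "(\<Sum>(t, K)\<in>p - q. (c + e) * (Sup K - Inf K)) = (c + e) * (b - a - l)"
      using len sum_diff[OF pD(1) q(3), of "\<lambda>(t, K). Sup K - Inf K"]
      by (simp add: l_def sum_distrib_left[symmetric] split_beta)
    moreover have "f b - f a = (\<Sum>(t, K)\<in>p - q. f (Sup K) - f (Inf K)) + (\<Sum>(t, K)\<in>q. f (Sup K) - f (Inf K))"
      using additive_tagged_division_1[OF ab p(1), of f] sum.subset_diff[OF q(3) pD(1)] by metis
    ultimately show ?thesis using sum_pq sum_q by (simp add: algebra_simps)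
  qed
  have "((\<lambda>e. c * (b - a) + e * (b - a + 2)) \<longlongrightarrow> c * (b - a) + 0 * (b - a + 2)) (at_right 0)"
    by (intro tendsto_intros)
  moreover have "eventually (\<lambda>e. f b - f a \<le> c * (b - a) + e * (b - a + 2)) (at_right 0)"
    using eventually_at_right_less by eventually_elim (rule approx)
  ultimately show ?thesis
    by (intro tendsto_lowerbound) auto
qed


text \<open>The scalar estimate applied to the component of \<open>z\<close> in the direction of its increment.\<close>

lemma abs_continuous_increment_norm_le:
  fixes z :: "real \<Rightarrow> 'a::real_inner"
  assumes ab: "a \<le> b" and z: "abs_continuous_on {a..b} z" and N: "negligible N"
    and deriv: "\<And>t. t \<in> {a..b} - N \<Longrightarrow>
      \<exists>v. norm v \<le> M \<and> (z has_vector_derivative v) (at t within {a..b})"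
  shows "norm (z b - z a) \<le> M * (b - a)"
proof (cases "z b = z a")
  case True
  show ?thesis
  proof (cases "{a..b} \<subseteq> N")
    case True
    then have "\<not> a < b"
      using N negligible_subset[OF N True] negligible_interval(1)[of a b] by (auto simp: cbox_interval)
    with ab \<open>z b = z a\<close> show ?thesis by simp
  next
    case False
    then obtain t where "t \<in> {a..b} - N" by blast
    from deriv[OF this] have "M \<ge> 0" by (meson norm_ge_zero order_trans)
    with ab \<open>z b = z a\<close> show ?thesis by simp
  qed
next
  case False
  define u where "u = z b - z a"
  have "u \<noteq> 0" using False by (simp add: u_def)
  have "(norm u)-lipschitz_on UNIV (\<lambda>w. w \<bullet> u)"
  proof (rule lipschitz_onI)
    show "dist (x \<bullet> u) (y \<bullet> u) \<le> norm u * dist x y" for x y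
      using Cauchy_Schwarz_ineq2[of "x - y" u]
      by (simp add: dist_real_def dist_norm inner_diff_left mult.commute)
  qed simp
  then have "abs_continuous_on {a..b} (\<lambda>t. z t \<bullet> u)"
    by (rule abs_continuous_on_lipschitz_compose[OF z]) simp
  then have "z b \<bullet> u - z a \<bullet> u \<le> (M * norm u) * (b - a)"
  proof (rule abs_continuous_increment_le[OF ab _ N])
    fix t assume "t \<in> {a..b} - N"
    from deriv[OF this] obtain v where v: "norm v \<le> M"
      "(z has_vector_derivative v) (at t within {a..b})" by blast
    have "v \<bullet> u \<le> norm v * norm u" by (rule norm_cauchy_schwarz)
    also have "\<dots> \<le> M * norm u" using v(1) by (simp add: mult_right_mono)
    finally have "v \<bullet> u \<le> M * norm u" .
    moreover have "((\<lambda>t. z t \<bullet> u) has_vector_derivative v \<bullet> u) (at t within {a..b})"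
      by (rule bounded_linear.has_vector_derivative[OF bounded_linear_inner_left v(2)])
    ultimately show "\<exists>D\<le>M * norm u. ((\<lambda>t. z t \<bullet> u) has_vector_derivative D) (at t within {a..b})"
      by blast
  qed
  then have "norm u * norm u \<le> norm u * (M * (b - a))"
    by (simp add: u_def inner_diff_left[symmetric] power2_norm_eq_inner[symmetric]
        power2_eq_square mult_ac)
  then show ?thesis using \<open>u \<noteq> 0\<close> by (simp add: u_def)
qed


section \<open>Trajectories along which every storage function dissipates\<close>

text \<open>A form of LaSalle's principle with a whole family of storage functions \<open>\<phi> s\<close>, each dissipated at
  rate \<open>- h s\<close>. Suppose that the trajectory has a limit point \<open>w\<close> at positive distance from \<open>A\<close>, and
  let \<open>h s w < 0\<close>. By continuity \<open>h s\<close> stays below a negative constant near \<open>w\<close>, and by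
  Lipschitz continuity a trajectory that comes near \<open>w\<close> stays there for a fixed time. One
  visit that starts when \<open>\<phi> s\<close> is already close to its infimum contradicts the infimum.\<close>

lemma dissipation_imp_convergence:
  fixes z :: "real \<Rightarrow> 'a::metric_space" and h :: "'s \<Rightarrow> 'a \<Rightarrow> real" and \<phi> :: "'s \<Rightarrow> real \<Rightarrow> real"
  assumes K: "compact K" and zK: "\<And>t. t \<ge> 0 \<Longrightarrow> z t \<in> K" and lip: "M-lipschitz_on {0..} z"
    and cont: "\<And>s. s \<in> S \<Longrightarrow> continuous_on K (h s)"
    and nonpos: "\<And>s w. s \<in> S \<Longrightarrow> w \<in> K \<Longrightarrow> h s w \<le> 0"
    and nonneg: "\<And>s t. s \<in> S \<Longrightarrow> t \<ge> 0 \<Longrightarrow> \<phi> s t \<ge> 0"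
    and decrease: "\<And>s a b c. s \<in> S \<Longrightarrow> 0 \<le> a \<Longrightarrow> a \<le> b \<Longrightarrow>
      (\<And>t. t \<in> {a..b} \<Longrightarrow> h s (z t) \<le> c) \<Longrightarrow> \<phi> s b - \<phi> s a \<le> c * (b - a)"
    and strict: "\<And>w. w \<in> K - A \<Longrightarrow> \<exists>s\<in>S. h s w < 0"
  shows "((\<lambda>t. infdist (z t) A) \<longlongrightarrow> 0) at_top"
proof (rule ccontr)
  assume "\<not> ?thesis"
  then obtain e where e: "e > 0" and "\<not> eventually (\<lambda>t. dist (infdist (z t) A) 0 < e) at_top"
    unfolding tendsto_iff by blast
  then have "\<exists>t\<ge>T. infdist (z t) A \<ge> e" for T :: real
    unfolding eventually_at_top_linorder
    by (metis dist_0_norm dist_commute infdist_nonneg not_less real_norm_def abs_of_nonneg)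
  then have "\<forall>k::nat. \<exists>t. real k \<le> t \<and> infdist (z t) A \<ge> e" by blast
  then obtain \<tau> :: "nat \<Rightarrow> real" where \<tau>: "\<And>k. \<tau> k \<ge> real k" "\<And>k. infdist (z (\<tau> k)) A \<ge> e"
    by metis
  have \<tau>0: "\<tau> k \<ge> 0" for k using \<tau>(1)[of k] by linarith
  have "\<forall>k. z (\<tau> k) \<in> K" using zK \<tau>0 by blast
  then obtain w r where w: "w \<in> K" and r: "strict_mono r" "((\<lambda>k. z (\<tau> k)) \<circ> r) \<longlonglongrightarrow> w"
    using seq_compactE[OF K[unfolded compact_eq_seq_compact_metric], of "\<lambda>k. z (\<tau> k)"] by metis
  have "(\<lambda>k. infdist (((\<lambda>k. z (\<tau> k)) \<circ> r) k) A) \<longlonglongrightarrow> infdist w A"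
    by (intro tendsto_infdist r)
  then have "e \<le> infdist w A"
    by (rule tendsto_lowerbound) (auto simp: \<tau>(2))
  then have "w \<notin> A" using e by auto
  with strict w obtain s where s: "s \<in> S" and hw: "h s w < 0" by blast
  define c where "c = - h s w / 2"
  have "c > 0" using hw by (simp add: c_def)
  from cont[OF s] w \<open>c > 0\<close> obtain \<rho> where "\<rho> > 0"
    and \<rho>: "\<And>y. y \<in> K \<Longrightarrow> dist y w < \<rho> \<Longrightarrow> dist (h s y) (h s w) < c"
    unfolding continuous_on_iff by metis
  have M: "M \<ge> 0" using lip by (rule lipschitz_on_nonneg)
  \<comment> \<open>Starting within \<open>\<rho> / 2\<close> of the limit point, the trajectory needs at least this much time to
    leave the ball of radius \<open>\<rho>\<close>.\<close>
  define \<eta> where "\<eta> = \<rho> / (2 * (M + 1))"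
  have "\<eta> > 0" using M \<open>\<rho> > 0\<close> by (simp add: \<eta>_def)
  have "M * \<eta> \<le> (M + 1) * \<eta>" using \<open>\<eta> > 0\<close> by simp
  also have "\<dots> = \<rho> / 2" using M by (simp add: \<eta>_def field_simps)
  finally have M\<eta>: "M * \<eta> \<le> \<rho> / 2" .
  define \<mu> where "\<mu> = (INF t\<in>{0..}. \<phi> s t)"
  have bdd: "bdd_below (\<phi> s ` {0..})" using nonneg[OF s] by (auto intro!: bdd_belowI2[of _ 0])
  have "\<mu> < \<mu> + c * \<eta>" using \<open>c > 0\<close> \<open>\<eta> > 0\<close> by simp
  then obtain T where T: "T \<ge> 0" "\<phi> s T < \<mu> + c * \<eta>"
    unfolding \<mu>_def using cInf_lessD[of "\<phi> s ` {0..}"] by fastforce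
  have "eventually (\<lambda>k. dist (((\<lambda>k. z (\<tau> k)) \<circ> r) k) w < \<rho> / 2) sequentially"
    using tendstoD[OF r(2), of "\<rho> / 2"] \<open>\<rho> > 0\<close> by simp
  moreover have "eventually (\<lambda>k. k \<ge> nat \<lceil>T\<rceil>) sequentially"
    by (rule eventually_ge_at_top)
  ultimately have "eventually (\<lambda>k. dist (z (\<tau> (r k))) w < \<rho> / 2 \<and> k \<ge> nat \<lceil>T\<rceil>) sequentially"
    by eventually_elim simp
  then obtain k where k: "dist (z (\<tau> (r k))) w < \<rho> / 2" "k \<ge> nat \<lceil>T\<rceil>"
    using eventually_happens'[OF sequentially_bot] by blast
  define t where "t = \<tau> (r k)"
  have "T \<le> real k" using k(2) by linarith
  also have "\<dots> \<le> real (r k)" using seq_suble[OF r(1), of k] by simp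
  also have "\<dots> \<le> t" using \<tau>(1) by (simp add: t_def)
  finally have Tt: "T \<le> t" .
  have "\<phi> s (t + \<eta>) - \<phi> s t \<le> - c * ((t + \<eta>) - t)"
  proof (rule decrease[OF s])
    fix t' assume t': "t' \<in> {t..t + \<eta>}"
    have "dist (z t') (z t) \<le> M * dist t' t"
      using t' T(1) Tt by (intro lipschitz_onD[OF lip]) auto
    also have "\<dots> \<le> M * \<eta>" using t' M by (intro mult_left_mono) (auto simp: dist_real_def)
    finally have "dist (z t') w < \<rho>"
      using dist_triangle[of "z t'" w "z t"] k(1) M\<eta> by (simp add: t_def)
    then have "dist (h s (z t')) (h s w) < c" using t' T(1) Tt by (intro \<rho> zK) auto
    then show "h s (z t') \<le> - c" by (simp add: c_def dist_real_def abs_less_iff)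
  qed (use T(1) Tt \<open>\<eta> > 0\<close> in auto)
  moreover have "\<phi> s t - \<phi> s T \<le> 0 * (t - T)"
    using T(1) Tt by (intro decrease[OF s] nonpos[OF s] zK) auto
  moreover have "\<mu> \<le> \<phi> s (t + \<eta>)"
    unfolding \<mu>_def using T(1) Tt \<open>\<eta> > 0\<close> by (intro cINF_lower[OF bdd]) auto
  ultimately show False using T(2) by simp
qed


section \<open>Normal cones and viable velocities\<close>

text \<open>By convexity the directions \<open>y - x\<close> into the set are tangent: approach \<open>x\<close> along the segment.\<close>

lemma normal_cone_inner_diff_le:
  assumes "convex C" "x \<in> C" "y \<in> C" "\<eta> \<in> normal_cone C x"
  shows "\<eta> \<bullet> (y - x) \<le> 0"
proof -
  define t :: "nat \<Rightarrow> real" where "t k = 1 / real (Suc k)" for k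
  have "y - x \<in> tangent_cone C x"
    unfolding tangent_cone_def
  proof (intro CollectI exI[of _ "\<lambda>k. (1 - t k) *\<^sub>R x + t k *\<^sub>R y"] exI[of _ t] conjI allI)
    show "(1 - t k) *\<^sub>R x + t k *\<^sub>R y \<in> C" for k
      using assms by (intro convexD) (auto simp: t_def)
    show "decseq t" by (rule decseq_SucI) (simp add: t_def frac_le)
    show "t \<longlonglongrightarrow> 0" unfolding t_def by (rule LIMSEQ_Suc[OF lim_1_over_n])
    have "(\<lambda>k. ((1 - t k) *\<^sub>R x + t k *\<^sub>R y - x) /\<^sub>R t k) = (\<lambda>k. y - x)"
    proof
      fix k
      have "(1 - t k) *\<^sub>R x + t k *\<^sub>R y - x = t k *\<^sub>R (y - x)" by (simp add: algebra_simps)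
      moreover have "t k \<noteq> 0" by (simp add: t_def)
      ultimately show "((1 - t k) *\<^sub>R x + t k *\<^sub>R y - x) /\<^sub>R t k = y - x" by simp
    qed
    then show "(\<lambda>k. ((1 - t k) *\<^sub>R x + t k *\<^sub>R y - x) /\<^sub>R t k) \<longlonglongrightarrow> y - x" by simp
  qed (simp add: t_def)
  with assms(4) show ?thesis by (auto simp: normal_cone_def)
qed

lemma normal_coneI:
  assumes "\<And>y. y \<in> C \<Longrightarrow> \<eta> \<bullet> (y - x) \<le> 0"
  shows "\<eta> \<in> normal_cone C x"
  unfolding normal_cone_def tangent_cone_def
proof (clarify)
  fix v u and t :: "nat \<Rightarrow> real"
  assume u: "\<forall>k. u k \<in> C" and t: "\<forall>k. 0 < t k" and lim: "(\<lambda>k. (u k - x) /\<^sub>R t k) \<longlonglongrightarrow> v"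
  have "\<eta> \<bullet> ((u k - x) /\<^sub>R t k) \<le> 0" for k
    using assms[of "u k"] u t by (simp add: mult_nonneg_nonpos less_imp_le)
  then show "\<eta> \<bullet> v \<le> 0"
    by (intro tendsto_upperbound[OF tendsto_inner[OF tendsto_const lim]]) auto
qed

text \<open>The difference quotients along times \<open>t + c * s\<^sub>k\<close>, with \<open>s\<^sub>k \<down> 0\<close>, exhibit \<open>c *\<^sub>R v\<close> as a tangent.
  The sign \<open>c = - 1\<close> looks into the past, which is possible only since \<open>t > 0\<close>.\<close>

lemma viable_velocity_in_tangent_cone:
  fixes z :: "real \<Rightarrow> 'a::real_inner"
  assumes t: "t > 0" and zC: "\<And>s. s \<ge> 0 \<Longrightarrow> z s \<in> C"
    and v: "(z has_vector_derivative v) (at t)" and c: "\<bar>c\<bar> = 1"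
  shows "c *\<^sub>R v \<in> tangent_cone C (z t)"
proof -
  define s :: "nat \<Rightarrow> real" where "s k = t / real (Suc k)" for k
  have s0: "s k > 0" for k using t by (simp add: s_def)
  have slim: "s \<longlonglongrightarrow> 0"
    unfolding s_def by (rule LIMSEQ_Suc[OF lim_const_over_n])
  have "filterlim (\<lambda>k. t + c * s k) (at t) sequentially"
    unfolding filterlim_at
  proof
    have "(\<lambda>k. t + c * s k) \<longlonglongrightarrow> t + c * 0" by (intro tendsto_intros slim)
    then show "(\<lambda>k. t + c * s k) \<longlonglongrightarrow> t" by simp
    show "\<forall>\<^sub>F k in sequentially. t + c * s k \<in> UNIV \<and> t + c * s k \<noteq> t"
      using c s0 by (intro always_eventually) (auto simp: less_imp_neq[symmetric])
  qed
  moreover have "((\<lambda>y. norm (z y - z t - (y - t) *\<^sub>R v) / norm (y - t)) \<longlongrightarrow> 0) (at t)"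
    using v unfolding has_vector_derivative_def has_derivative_iff_norm by blast
  ultimately have "(\<lambda>k. norm (z (t + c * s k) - z t - (t + c * s k - t) *\<^sub>R v)
      / norm (t + c * s k - t)) \<longlonglongrightarrow> 0"
    by (rule filterlim_compose[rotated])
  also have "(\<lambda>k. norm (z (t + c * s k) - z t - (t + c * s k - t) *\<^sub>R v) / norm (t + c * s k - t))
      = (\<lambda>k. norm ((z (t + c * s k) - z t) /\<^sub>R s k - c *\<^sub>R v))"
  proof
    fix k
    have "(z (t + c * s k) - z t) /\<^sub>R s k - c *\<^sub>R v = (z (t + c * s k) - z t - (c * s k) *\<^sub>R v) /\<^sub>R s k"
      using s0[of k] by (simp add: scaleR_diff_right)
    then show "norm (z (t + c * s k) - z t - (t + c * s k - t) *\<^sub>R v) / norm (t + c * s k - t)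
        = norm ((z (t + c * s k) - z t) /\<^sub>R s k - c *\<^sub>R v)"
      using c s0[of k] by (simp add: abs_mult divide_inverse mult.commute)
  qed
  finally have "(\<lambda>k. (z (t + c * s k) - z t) /\<^sub>R s k) \<longlonglongrightarrow> c *\<^sub>R v"
    by (simp add: tendsto_norm_zero_iff LIM_zero_iff)
  moreover have "z (t + c * s k) \<in> C" for k
  proof (rule zC)
    have "s k \<le> t / 1" unfolding s_def using t by (intro divide_left_mono) auto
    moreover have "- c * s k \<le> 1 * s k" using c s0[of k] by (intro mult_right_mono) auto
    ultimately show "0 \<le> t + c * s k" by simp
  qed
  moreover have "decseq s" using t by (intro decseq_SucI) (simp add: s_def frac_le)
  ultimately show ?thesis
    unfolding tangent_cone_def using s0 slim
    by (intro CollectI exI[of _ "\<lambda>k. z (t + c * s k)"] exI[of _ s]) simp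
qed

lemma normal_orthogonal_viable_velocity:
  fixes z :: "real \<Rightarrow> 'a::real_inner"
  assumes "t > 0" and "\<And>s. s \<ge> 0 \<Longrightarrow> z s \<in> C"
    and "(z has_vector_derivative v) (at t)" and \<eta>: "\<eta> \<in> normal_cone C (z t)"
  shows "\<eta> \<bullet> v = 0"
proof -
  have "v \<in> tangent_cone C (z t)" "- v \<in> tangent_cone C (z t)"
    using viable_velocity_in_tangent_cone[OF assms(1-3), of 1]
      viable_velocity_in_tangent_cone[OF assms(1-3), of "-1"] by auto
  moreover have "\<forall>w\<in>tangent_cone C (z t). \<eta> \<bullet> w \<le> 0"
    using \<eta> by (simp add: normal_cone_def)
  ultimately have "\<eta> \<bullet> v \<le> 0" "\<eta> \<bullet> - v \<le> 0" by blast+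
  then show ?thesis by simp
qed


section \<open>Convex functions with bounded subdifferentials\<close>

text \<open>Lets every statement about the maximizing player be read off from the one about the minimizing
  player, with \<open>- L\<close> in place of \<open>L\<close>.\<close>

lemma superdifferential_iff_subdifferential_uminus:
  "g \<in> superdifferential f x \<longleftrightarrow> - g \<in> subdifferential (\<lambda>y. - f y) x"
proof -
  have "(f y \<le> f x + ereal c) \<longleftrightarrow> (- f x + ereal (- c) \<le> - f y)" for y c
    by (cases "f x"; cases "f y") auto
  then show ?thesis
    by (simp add: superdifferential_def subdifferential_def inner_minus_left)
qed

text \<open>At an infinite value the defining inequality of a subgradient holds for all vectors or for none.\<close>

lemma subdifferential_bounded_imp_finite:
  fixes f :: "'a::euclidean_space \<Rightarrow> ereal"
  assumes ne: "subdifferential f x \<noteq> {}"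
    and bound: "\<And>g. g \<in> subdifferential f x \<Longrightarrow> norm g \<le> G"
  shows "\<bar>f x\<bar> \<noteq> \<infinity>"
proof
  assume inf: "\<bar>f x\<bar> = \<infinity>"
  have "g \<in> subdifferential f x" for g
    using ne inf by (cases "f x") (auto simp: subdifferential_def split: if_splits)
  moreover obtain g :: 'a where "norm g = \<bar>G\<bar> + 1"
    using vector_choose_size[of "\<bar>G\<bar> + 1"] by auto
  ultimately show False using bound[of g] by simp
qed

lemma subdifferential_bounded_imp_lipschitz:
  fixes f :: "'a::euclidean_space \<Rightarrow> ereal"
  assumes ne: "\<And>x. x \<in> X \<Longrightarrow> subdifferential f x \<noteq> {}"
    and bound: "\<And>x g. x \<in> X \<Longrightarrow> g \<in> subdifferential f x \<Longrightarrow> norm g \<le> G" and G: "G \<ge> 0"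
  shows "G-lipschitz_on X (\<lambda>x. real_of_ereal (f x))"
proof (rule lipschitz_onI)
  have le: "real_of_ereal (f x) - real_of_ereal (f y) \<le> G * dist x y" if "x \<in> X" "y \<in> X" for x y
  proof -
    obtain g where g: "g \<in> subdifferential f x" using ne \<open>x \<in> X\<close> by blast
    have "\<bar>f x\<bar> \<noteq> \<infinity>" "\<bar>f y\<bar> \<noteq> \<infinity>"
      using subdifferential_bounded_imp_finite ne bound that by metis+
    moreover have "f x + ereal (g \<bullet> (y - x)) \<le> f y" using g by (simp add: subdifferential_def)
    ultimately have "real_of_ereal (f x) + g \<bullet> (y - x) \<le> real_of_ereal (f y)"
      by (cases "f x"; cases "f y") auto
    moreover have "- (g \<bullet> (y - x)) \<le> norm g * norm (y - x)"
      using Cauchy_Schwarz_ineq2[of g "y - x"] by linarith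
    moreover have "norm g * norm (y - x) \<le> G * dist x y"
      using bound[OF \<open>x \<in> X\<close> g] by (simp add: dist_norm norm_minus_commute mult_right_mono)
    ultimately show ?thesis by linarith
  qed
  fix x y assume "x \<in> X" "y \<in> X"
  then show "dist (real_of_ereal (f x)) (real_of_ereal (f y)) \<le> G * dist x y"
    using le[of x y] le[of y x] by (simp add: dist_real_def dist_commute abs_le_iff)
qed (rule G)

text \<open>Separate the epigraph of \<open>f\<close> from the part of \<open>X \<times> \<real>\<close> strictly below the level \<open>f x0\<close>. A
  separating hyperplane that is not vertical is the graph of an affine function whose slope is
  the subgradient sought. Boundedness of the subdifferential serves as the constraint
  qualification that excludes a vertical one.\<close>

lemma constrained_minimum_imp_subgradient_normal:
  fixes f :: "'a::euclidean_space \<Rightarrow> ereal"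
  assumes f: "ext_convex f" and X: "convex X" "x0 \<in> X"
    and min: "\<And>x. x \<in> X \<Longrightarrow> f x0 \<le> f x"
    and ne: "subdifferential f x0 \<noteq> {}"
    and bound: "\<And>g. g \<in> subdifferential f x0 \<Longrightarrow> norm g \<le> G"
  shows "\<exists>g\<in>subdifferential f x0. - g \<in> normal_cone X x0"
proof -
  have "\<bar>f x0\<bar> \<noteq> \<infinity>" by (rule subdifferential_bounded_imp_finite[OF ne bound])
  then obtain m where m: "f x0 = ereal m" by auto
  define E where "E = {(x, r::real). f x \<le> ereal r}"
  have "convex E" using f by (simp add: ext_convex_def E_def)
  moreover have "convex (X \<times> {..<m})" using X by (intro convex_Times) auto
  moreover have "X \<times> {..<m} \<noteq> {}" using X(2) lt_ex[of m] by auto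
  moreover have "(x0, m) \<in> E" by (simp add: E_def m)
  moreover have "(X \<times> {..<m}) \<inter> E = {}"
  proof (rule ccontr)
    assume "(X \<times> {..<m}) \<inter> E \<noteq> {}"
    then obtain x r where "x \<in> X" "r < m" "f x \<le> ereal r" by (auto simp: E_def)
    with min[of x] m have "ereal m \<le> ereal r" by (metis order_trans)
    with \<open>r < m\<close> show False by simp
  qed
  ultimately obtain a b where "a \<noteq> 0" and a: "\<forall>w\<in>X \<times> {..<m}. a \<bullet> w \<le> b" "\<forall>w\<in>E. a \<bullet> w \<ge> b"
    using separating_hyperplane_sets[of "X \<times> {..<m}" E] by blast
  obtain p q where pq: "a = (p, q)" by (cases a)
  have below: "p \<bullet> x + q * s \<le> b" if "x \<in> X" "s < m" for x s
    using a(1) that by (auto simp: pq inner_Pair)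
  have epi: "b \<le> p \<bullet> y + q * r" if "f y \<le> ereal r" for y r
    using a(2) that by (auto simp: pq inner_Pair E_def)
  have below_m: "p \<bullet> x + q * m \<le> b" if "x \<in> X" for x
  proof -
    have "((\<lambda>s. p \<bullet> x + q * s) \<longlongrightarrow> p \<bullet> x + q * m) (at_left m)"
      by (intro tendsto_intros)
    moreover have "\<forall>\<^sub>F s in at_left m. p \<bullet> x + q * s \<le> b"
      using below[OF that] by (simp add: eventually_at_filter)
    ultimately show ?thesis by (rule tendsto_upperbound) simp
  qed
  have b: "b = p \<bullet> x0 + q * m" using below_m[OF X(2)] epi[of x0 m] m by auto
  have "q \<ge> 0" using below[OF X(2), of "m - 1"] by (simp add: b algebra_simps)
  show ?thesis
  proof (cases "q = 0")
    case False
    with \<open>q \<ge> 0\<close> have q: "q > 0" by simp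
    define g where "g = - (p /\<^sub>R q)"
    have "f x0 + ereal (g \<bullet> (y - x0)) \<le> f y" for y
    proof (rule ereal_le_real)
      fix r assume "f y \<le> ereal r"
      from epi[OF this] have "q * m + p \<bullet> x0 - p \<bullet> y \<le> q * r" by (simp add: b)
      then have "(q * m + p \<bullet> x0 - p \<bullet> y) / q \<le> r" using q by (simp add: pos_divide_le_eq mult.commute)
      also have "(q * m + p \<bullet> x0 - p \<bullet> y) / q = m + g \<bullet> (y - x0)"
        using q by (simp add: g_def inner_diff_right field_simps)
      finally show "f x0 + ereal (g \<bullet> (y - x0)) \<le> ereal r" by (simp add: m)
    qed
    then have "g \<in> subdifferential f x0" by (simp add: subdifferential_def)
    moreover have "- g \<in> normal_cone X x0"
    proof (rule normal_coneI)
      fix y assume "y \<in> X"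
      from below_m[OF this] have "p \<bullet> (y - x0) \<le> 0" by (simp add: b inner_diff_right)
      then show "- g \<bullet> (y - x0) \<le> 0"
        using q by (simp add: g_def mult_nonneg_nonpos)
    qed
    ultimately show ?thesis by blast
  next
    \<comment> \<open>A vertical separating hyperplane makes \<open>- p\<close> a normal of the domain of \<open>f\<close> at \<open>x0\<close>,
      and adding multiples of such a normal to a subgradient yields unboundedly many
      subgradients.\<close>
    case True
    with \<open>a \<noteq> 0\<close> pq have "p \<noteq> 0" by (auto simp: zero_prod_def)
    obtain g0 where g0: "g0 \<in> subdifferential f x0" using ne by blast
    define t where "t = (2 * \<bar>G\<bar> + 1) / norm p"
    have "t \<ge> 0" by (simp add: t_def)
    have "f x0 + ereal ((g0 - t *\<^sub>R p) \<bullet> (y - x0)) \<le> f y" for y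
    proof (rule ereal_le_real)
      fix r assume r: "f y \<le> ereal r"
      have "p \<bullet> (y - x0) \<ge> 0" using epi[OF r] True by (simp add: b inner_diff_right)
      then have "(g0 - t *\<^sub>R p) \<bullet> (y - x0) \<le> g0 \<bullet> (y - x0)"
        using \<open>t \<ge> 0\<close> by (simp add: inner_diff_left)
      then have "f x0 + ereal ((g0 - t *\<^sub>R p) \<bullet> (y - x0)) \<le> f x0 + ereal (g0 \<bullet> (y - x0))"
        by (simp add: m)
      also have "\<dots> \<le> f y" using g0 by (simp add: subdifferential_def)
      finally show "f x0 + ereal ((g0 - t *\<^sub>R p) \<bullet> (y - x0)) \<le> ereal r" using r by simp
    qed
    then have "norm (g0 - t *\<^sub>R p) \<le> G" by (intro bound) (simp add: subdifferential_def)
    moreover have "norm (t *\<^sub>R p) = 2 * \<bar>G\<bar> + 1"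
      using \<open>p \<noteq> 0\<close> by (simp add: t_def abs_of_nonneg)
    moreover have "norm (t *\<^sub>R p) \<le> norm g0 + norm (g0 - t *\<^sub>R p)"
      using norm_triangle_ineq4[of g0 "g0 - t *\<^sub>R p"] by simp
    ultimately show ?thesis using bound[OF g0] by linarith
  qed
qed


section \<open>Mirror maps and their Bregman divergences\<close>

lemma differentiable_imp_gradient:
  fixes f :: "'a::euclidean_space \<Rightarrow> real"
  assumes "f differentiable (at x)"
  shows "(f has_derivative (\<lambda>h. gradient f x \<bullet> h)) (at x)"
proof -
  from assms obtain f' where f': "(f has_derivative f') (at x)" by (auto simp: differentiable_def)
  then have "f' h = h \<bullet> adjoint f' 1" for h
    using adjoint_works[OF has_derivative_linear[OF f'], of h 1] by simp
  then have "f' = (\<lambda>h. h \<bullet> adjoint f' 1)" by blast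
  with f' have "GDERIV f x :> adjoint f' 1" unfolding gderiv_def by simp
  moreover from gradient_eqI[OF this] have "gradient f x = adjoint f' 1" .
  ultimately show ?thesis by (simp add: gderiv_def inner_commute)
qed

text \<open>Outside \<open>U\<close> the function \<open>R\<close> is arbitrary, and a segment between two points of \<open>U\<close> may leave
  \<open>U\<close>; hence strong convexity enters only through its limit form at a point of the open set \<open>U\<close>.\<close>

locale mirror_map =
  fixes X U :: "(real^'n) set" and R :: "real^'n \<Rightarrow> ereal" and \<sigma> :: real
  assumes convex_X: "convex X" and compact_X: "compact X"
    and open_U: "open U" and X_subset_U: "X \<subseteq> U"
    and C2: "ext_C2_on U R" and strongly_convex: "ext_strongly_convex_on U \<sigma> R"
    and \<sigma>_pos: "\<sigma> > 0"
begin

abbreviation r :: "real^'n \<Rightarrow> real" where "r \<equiv> \<lambda>x. real_of_ereal (R x)"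

lemma has_derivative_r:
  assumes "x \<in> U"
  shows "(r has_derivative (\<lambda>h. gradient r x \<bullet> h)) (at x)"
  using C2 assms by (intro differentiable_imp_gradient) (simp add: ext_C2_on_def C2_on_def)

lemma has_derivative_gradient:
  assumes "x \<in> U"
  shows "(gradient r has_derivative (\<lambda>h. hessian r x *v h)) (at x)"
proof -
  have "gradient r differentiable (at x)"
    using C2 assms by (simp add: ext_C2_on_def C2_on_def)
  then show ?thesis unfolding hessian_def by (simp add: jacobian_works)
qed

lemma strongly_convex_real:
  assumes x: "x \<in> U" and y: "y \<in> U" and t: "t \<in> {0..1}" and m: "x + t *\<^sub>R (y - x) \<in> U"
  shows "r (x + t *\<^sub>R (y - x)) \<le> (1 - t) * r x + t * r y - \<sigma> / 2 * t * (1 - t) * (norm (x - y))\<^sup>2"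
proof -
  have eq: "(1 - t) *\<^sub>R x + t *\<^sub>R y = x + t *\<^sub>R (y - x)" by (simp add: algebra_simps)
  have "\<bar>R x\<bar> \<noteq> \<infinity>" "\<bar>R y\<bar> \<noteq> \<infinity>" "\<bar>R (x + t *\<^sub>R (y - x))\<bar> \<noteq> \<infinity>"
    using C2 x y m by (auto simp: ext_C2_on_def)
  then obtain a b c where "R x = ereal a" "R y = ereal b" "R (x + t *\<^sub>R (y - x)) = ereal c"
    by (metis ereal_real')
  with strongly_convex x y t show ?thesis
    unfolding ext_strongly_convex_on_def by (fastforce simp: eq)
qed

text \<open>Near \<open>x\<close> the segment from \<open>x\<close> to \<open>y\<close> lies in the open set \<open>U\<close>, even if the whole segment does
  not. Divide the strong convexity inequality by \<open>t\<close> there and let \<open>t\<close> tend to \<open>0\<close> from the right.\<close>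

lemma strongly_convex_first_order:
  assumes x: "x \<in> U" and y: "y \<in> U"
  shows "r x + gradient r x \<bullet> (y - x) + \<sigma> / 2 * (norm (y - x))\<^sup>2 \<le> r y"
proof -
  have "((\<lambda>t. x + t *\<^sub>R (y - x)) has_derivative (\<lambda>t. t *\<^sub>R (y - x))) (at 0)"
    by (auto intro!: derivative_eq_intros)
  moreover have "(r has_derivative (\<lambda>h. gradient r x \<bullet> h)) (at (x + 0 *\<^sub>R (y - x)))"
    using has_derivative_r[OF x] by simp
  ultimately have "((\<lambda>t. r (x + t *\<^sub>R (y - x))) has_derivative (\<lambda>t. gradient r x \<bullet> (t *\<^sub>R (y - x)))) (at 0)"
    by (rule has_derivative_compose)
  then have "((\<lambda>t. r (x + t *\<^sub>R (y - x))) has_field_derivative gradient r x \<bullet> (y - x)) (at 0)"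
    by (simp add: has_field_derivative_def mult_commute_abs)
  then have "((\<lambda>t. (r (x + t *\<^sub>R (y - x)) - r x) / t) \<longlongrightarrow> gradient r x \<bullet> (y - x)) (at_right 0)"
    by (auto simp: has_field_derivative_iff intro: filterlim_mono[OF _ order_refl at_le])
  moreover have "((\<lambda>t. r y - r x - \<sigma> / 2 * (1 - t) * (norm (x - y))\<^sup>2) \<longlongrightarrow>
      r y - r x - \<sigma> / 2 * (1 - 0) * (norm (x - y))\<^sup>2) (at_right 0)"
    by (intro tendsto_intros)
  moreover have "\<forall>\<^sub>F t in at_right 0. (r (x + t *\<^sub>R (y - x)) - r x) / t
      \<le> r y - r x - \<sigma> / 2 * (1 - t) * (norm (x - y))\<^sup>2"
  proof -
    have "((\<lambda>t. x + t *\<^sub>R (y - x)) \<longlongrightarrow> x + 0 *\<^sub>R (y - x)) (at_right 0)"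
      by (intro tendsto_intros)
    then have "\<forall>\<^sub>F t in at_right 0. x + t *\<^sub>R (y - x) \<in> U"
      using topological_tendstoD[OF _ open_U] x by fastforce
    moreover have "\<forall>\<^sub>F t in at_right (0::real). 0 < t \<and> t < 1"
      by (rule eventually_at_rightI[of 0 1]) auto
    ultimately show ?thesis
    proof eventually_elim
      case (elim t)
      then have "r (x + t *\<^sub>R (y - x)) - r x \<le> t * (r y - r x - \<sigma> / 2 * (1 - t) * (norm (x - y))\<^sup>2)"
        using strongly_convex_real[OF x y, of t] by (simp add: algebra_simps)
      with elim show ?case by (simp add: pos_divide_le_eq mult.commute)
    qed
  qed
  ultimately have "gradient r x \<bullet> (y - x) \<le> r y - r x - \<sigma> / 2 * (1 - 0) * (norm (x - y))\<^sup>2"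
    by (intro tendsto_le[OF trivial_limit_at_right_real])
  then show ?thesis by (simp add: norm_minus_commute)
qed

lemma gradient_strongly_monotone:
  assumes "x \<in> U" "y \<in> U"
  shows "\<sigma> * (norm (y - x))\<^sup>2 \<le> (gradient r y - gradient r x) \<bullet> (y - x)"
  using strongly_convex_first_order[OF assms] strongly_convex_first_order[OF assms(2,1)]
  by (simp add: norm_minus_commute inner_diff_left inner_diff_right)

text \<open>The limit of strong monotonicity of the gradient along \<open>x + t *\<^sub>R v\<close>, divided by \<open>t\<^sup>2\<close>.\<close>

lemma hessian_coercive:
  assumes x: "x \<in> U"
  shows "\<sigma> * (norm v)\<^sup>2 \<le> (hessian r x *v v) \<bullet> v"
proof -
  have "((\<lambda>t. x + t *\<^sub>R v) has_derivative (\<lambda>t. t *\<^sub>R v)) (at 0)"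
    by (auto intro!: derivative_eq_intros)
  moreover have "(gradient r has_derivative (\<lambda>h. hessian r x *v h)) (at (x + 0 *\<^sub>R v))"
    using has_derivative_gradient[OF x] by simp
  ultimately have "((\<lambda>t. gradient r (x + t *\<^sub>R v)) has_derivative (\<lambda>t. hessian r x *v (t *\<^sub>R v))) (at 0)"
    by (rule has_derivative_compose)
  then have "((\<lambda>t. gradient r (x + t *\<^sub>R v) \<bullet> v) has_derivative (\<lambda>t. (hessian r x *v (t *\<^sub>R v)) \<bullet> v)) (at 0)"
    by (rule has_derivative_inner_left)
  then have "((\<lambda>t. gradient r (x + t *\<^sub>R v) \<bullet> v) has_field_derivative (hessian r x *v v) \<bullet> v) (at 0)"
    by (simp add: has_field_derivative_def mult_commute_abs matrix_vector_mult_scaleR)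
  then have "((\<lambda>t. (gradient r (x + t *\<^sub>R v) \<bullet> v - gradient r x \<bullet> v) / t) \<longlongrightarrow> (hessian r x *v v) \<bullet> v) (at_right 0)"
    by (auto simp: has_field_derivative_iff intro: filterlim_mono[OF _ order_refl at_le])
  moreover have "\<forall>\<^sub>F t in at_right 0. \<sigma> * (norm v)\<^sup>2 \<le> (gradient r (x + t *\<^sub>R v) \<bullet> v - gradient r x \<bullet> v) / t"
  proof -
    have "((\<lambda>t. x + t *\<^sub>R v) \<longlongrightarrow> x + 0 *\<^sub>R v) (at_right 0)"
      by (intro tendsto_intros)
    then have "\<forall>\<^sub>F t in at_right 0. x + t *\<^sub>R v \<in> U"
      using topological_tendstoD[OF _ open_U] x by fastforce
    moreover have "\<forall>\<^sub>F t in at_right (0::real). 0 < t"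
      by (rule eventually_at_right_less)
    ultimately show ?thesis
    proof eventually_elim
      case (elim t)
      have "t * (\<sigma> * (norm v)\<^sup>2 * t) \<le> t * (gradient r (x + t *\<^sub>R v) \<bullet> v - gradient r x \<bullet> v)"
        using gradient_strongly_monotone[OF x elim(1)] elim(2)
        by (simp add: power_mult_distrib inner_diff_left power2_eq_square mult_ac)
      with elim(2) have "\<sigma> * (norm v)\<^sup>2 * t \<le> gradient r (x + t *\<^sub>R v) \<bullet> v - gradient r x \<bullet> v"
        by (simp only: mult_le_cancel_left_pos)
      with elim(2) show ?case by (simp only: pos_le_divide_eq)
    qed
  qed
  ultimately show ?thesis
    by (intro tendsto_lowerbound[OF _ _ trivial_limit_at_right_real])
qed

lemma hessian_matrix_inv:
  assumes x: "x \<in> U"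
  shows "hessian r x *v (matrix_inv (hessian r x) *v w) = w"
proof -
  have "v = 0" if "hessian r x *v v = 0" for v
    using hessian_coercive[OF x, of v] \<sigma>_pos that by (auto simp: mult_le_0_iff)
  then have "invertible (hessian r x)"
    unfolding invertible_left_inverse matrix_left_invertible_ker by blast
  then have "hessian r x ** matrix_inv (hessian r x) = mat 1"
    unfolding invertible_def matrix_inv_def by (metis (mono_tags, lifting) someI_ex)
  then show ?thesis by (simp add: matrix_vector_mul_assoc)
qed

definition bregman :: "real^'n \<Rightarrow> real^'n \<Rightarrow> real" where
  "bregman p x = r p - r x - gradient r x \<bullet> (p - x)"

lemma bregman_self [simp]: "bregman p p = 0"
  by (simp add: bregman_def)

lemma bregman_ge:
  assumes "p \<in> U" "x \<in> U"
  shows "\<sigma> / 2 * (norm (x - p))\<^sup>2 \<le> bregman p x"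
  using strongly_convex_first_order[OF assms(2,1)] by (simp add: bregman_def norm_minus_commute)

text \<open>The two terms with the gradient of \<open>r\<close> cancel; only the derivative of the gradient remains.\<close>

lemma has_derivative_bregman:
  assumes x: "x \<in> U"
  shows "(bregman p has_derivative (\<lambda>h. - ((hessian r x *v h) \<bullet> (p - x)))) (at x)"
  unfolding bregman_def[abs_def]
  by (rule derivative_eq_intros has_derivative_r[OF x] has_derivative_gradient[OF x] refl)+
    (simp add: inner_minus_right)

lemma has_vector_derivative_bregman:
  assumes "(x has_vector_derivative v) (at t)" and "x t \<in> U"
  shows "((\<lambda>t. bregman p (x t)) has_vector_derivative - ((hessian r (x t) *v v) \<bullet> (p - x t))) (at t)"
proof -
  have "((\<lambda>t. bregman p (x t)) has_derivative (\<lambda>h. - ((hessian r (x t) *v (h *\<^sub>R v)) \<bullet> (p - x t)))) (at t)"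
    using assms(1) has_derivative_bregman[OF assms(2)]
    unfolding has_vector_derivative_def by (rule has_derivative_compose)
  then show ?thesis
    by (simp add: has_vector_derivative_def matrix_vector_mult_scaleR)
qed

text \<open>The Hessian is continuous, hence bounded on the compact set \<open>X\<close>, and so is the derivative of the
  divergence.\<close>

lemma bregman_lipschitz:
  obtains C where "C-lipschitz_on X (bregman p)"
proof -
  have "continuous_on X (hessian r)"
    using C2 X_subset_U continuous_on_subset by (auto simp: ext_C2_on_def C2_on_def)
  then have "bounded (hessian r ` X)"
    by (intro compact_imp_bounded compact_continuous_image compact_X)
  then obtain B where B: "\<And>x. x \<in> X \<Longrightarrow> norm (hessian r x) \<le> B"
    by (auto simp: bounded_iff)
  have "bounded ((\<lambda>x. p - x) ` X)"
    by (intro compact_imp_bounded compact_continuous_image compact_X continuous_intros)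
  then obtain D where D: "\<And>x. x \<in> X \<Longrightarrow> norm (p - x) \<le> D"
    by (auto simp: bounded_iff)
  define C where "C = \<bar>real CARD('n) * real CARD('n) * B * D\<bar>"
  have "C-lipschitz_on X (bregman p)"
  proof (rule bounded_derivative_imp_lipschitz[OF _ convex_X])
    fix x assume x: "x \<in> X"
    show "(bregman p has_derivative (\<lambda>h. - ((hessian r x *v h) \<bullet> (p - x)))) (at x within X)"
      using has_derivative_bregman x X_subset_U by (blast intro: has_derivative_at_withinI)
    show "onorm (\<lambda>h. - ((hessian r x *v h) \<bullet> (p - x))) \<le> C"
    proof (rule onorm_le)
      fix h
      have "onorm ((*v) (hessian r x)) \<le> real CARD('n) * real CARD('n) * B"
      proof (rule onorm_le_matrix_component)
        show "\<bar>hessian r x $ i $ j\<bar> \<le> B" for i j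
          using component_le_norm_cart[of "hessian r x $ i" j] B[OF x]
            Finite_Cartesian_Product.norm_nth_le[of "hessian r x" i] by linarith
      qed
      then have "norm (hessian r x *v h) \<le> real CARD('n) * real CARD('n) * B * norm h"
        using onorm[OF matrix_vector_mul_bounded_linear, of "hessian r x" h]
        by (meson mult_right_mono norm_ge_zero order_trans)
      then have "norm (hessian r x *v h) * norm (p - x) \<le> (real CARD('n) * real CARD('n) * B * norm h) * D"
        using D[OF x] by (intro mult_mono) (auto intro: order_trans[OF norm_ge_zero])
      also have "\<dots> \<le> C * norm h"
        using mult_right_mono[OF abs_ge_self[of "real CARD('n) * real CARD('n) * B * D"] norm_ge_zero[of h]]
        by (simp add: C_def mult_ac)
      finally show "norm (- ((hessian r x *v h) \<bullet> (p - x))) \<le> C * norm h"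
        using Cauchy_Schwarz_ineq2[of "hessian r x *v h" "p - x"] by simp
    qed
  qed (simp add: C_def)
  then show thesis by (rule that)
qed

text \<open>The left-hand side is the time derivative of \<open>bregman p\<close> at \<open>x\<close> along the velocity \<open>v\<close>.\<close>

lemma bregman_decrease:
  assumes x: "x \<in> X" and p: "p \<in> X"
    and v: "hessian r x *v v = - (g + \<eta>)"
    and g: "g \<in> subdifferential f x" and \<eta>: "\<eta> \<in> normal_cone X x"
    and fin: "\<bar>f x\<bar> \<noteq> \<infinity>" "\<bar>f p\<bar> \<noteq> \<infinity>"
  shows "- ((hessian r x *v v) \<bullet> (p - x)) \<le> real_of_ereal (f p) - real_of_ereal (f x)"
proof -
  have "f x + ereal (g \<bullet> (p - x)) \<le> f p" using g by (simp add: subdifferential_def)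
  with fin have "g \<bullet> (p - x) \<le> real_of_ereal (f p) - real_of_ereal (f x)"
    by (cases "f x"; cases "f p") auto
  moreover have "\<eta> \<bullet> (p - x) \<le> 0"
    by (rule normal_cone_inner_diff_le[OF convex_X x p \<eta>])
  ultimately show ?thesis by (simp add: v inner_diff_left)
qed

text \<open>Pair the equation for \<open>v\<close> with \<open>v\<close> itself: the normal drops out, and coercivity compares the
  squared norm of \<open>v\<close> with the norm of \<open>v\<close>.\<close>

lemma velocity_bound:
  assumes x: "x \<in> X" and v: "hessian r x *v v = - (g + \<eta>)" and g: "norm g \<le> G" and "\<eta> \<bullet> v = 0"
  shows "norm v \<le> G / \<sigma>"
proof -
  have "\<sigma> * (norm v)\<^sup>2 \<le> (hessian r x *v v) \<bullet> v"
    using hessian_coercive x X_subset_U by blast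
  also have "\<dots> = - (g \<bullet> v)" using assms by (simp add: inner_diff_left)
  also have "\<dots> \<le> norm g * norm v" using Cauchy_Schwarz_ineq2[of g v] by linarith
  also have "\<dots> \<le> G * norm v" using g by (simp add: mult_right_mono)
  finally have *: "norm v * (\<sigma> * norm v) \<le> norm v * G" by (simp add: power2_eq_square mult_ac)
  have "0 \<le> G" using g norm_ge_zero order_trans by blast
  show ?thesis
  proof (cases "v = 0")
    case False
    with * have "\<sigma> * norm v \<le> G" by simp
    then show ?thesis using \<sigma>_pos by (simp add: pos_le_divide_eq mult.commute)
  qed (use \<open>0 \<le> G\<close> \<sigma>_pos in simp)
qed

end


section \<open>The natural gradient flow of a saddle function\<close>

text \<open>At positive times the derivative relative to \<open>[0, \<infinity>)\<close> is two-sided; the velocity bound needs this.\<close>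

lemma viable_caratheodory_solution_derivative:
  assumes "viable_caratheodory_solution F C z0 z"
  obtains N where "negligible N"
    and "\<And>t. t > 0 \<Longrightarrow> t \<notin> N \<Longrightarrow> \<exists>v\<in>F (z t). (z has_vector_derivative v) (at t)"
proof -
  have "AE t in lebesgue. t \<ge> 0 \<longrightarrow> (\<exists>v\<in>F (z t). (z has_vector_derivative v) (at t within {0..}))"
    using assms by (simp add: viable_caratheodory_solution_def)
  then obtain N where N: "N \<in> null_sets lebesgue"
    "{t\<in>space lebesgue. \<not> (t \<ge> 0 \<longrightarrow> (\<exists>v\<in>F (z t). (z has_vector_derivative v) (at t within {0..})))} \<subseteq> N"
    unfolding eventually_ae_filter by blast
  show thesis
  proof (rule that)
    show "negligible N" using N(1) by (simp add: negligible_iff_null_sets)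
    fix t :: real assume t: "t > 0" "t \<notin> N"
    have "\<exists>v\<in>F (z t). (z has_vector_derivative v) (at t within {0..})"
    proof (rule ccontr)
      assume "\<not> ?thesis"
      then have "t \<in> N" using N(2) t(1) by (intro subsetD[OF N(2)]) simp
      with t(2) show False ..
    qed
    moreover have "at t within {0..} = at t"
      using t(1) by (intro at_within_interior) simp
    ultimately show "\<exists>v\<in>F (z t). (z has_vector_derivative v) (at t)" by simp
  qed
qed

locale saddle_flow =
  mx: mirror_map X Ux Rx \<sigma> + my: mirror_map Y Uy Ry \<sigma>
  for X :: "(real^'n) set" and Y :: "(real^'m) set"
    and Ux Uy and Rx :: "real^'n \<Rightarrow> ereal" and Ry :: "real^'m \<Rightarrow> ereal" and \<sigma> :: real +
  fixes L :: "real^'n \<Rightarrow> real^'m \<Rightarrow> ereal" and G :: real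
  assumes convex_L: "\<And>y. ext_convex (\<lambda>x. L x y)"
    and concave_L: "\<And>x. ext_concave (L x)"
    and subgradients: "\<And>x y. x \<in> X \<Longrightarrow> y \<in> Y \<Longrightarrow>
      subdifferential (\<lambda>x. L x y) x \<times> superdifferential (L x) y \<noteq> {}"
    and bound_x: "\<And>x y g. x \<in> X \<Longrightarrow> y \<in> Y \<Longrightarrow> g \<in> subdifferential (\<lambda>x. L x y) x \<Longrightarrow> norm g \<le> G"
    and bound_y: "\<And>x y g. x \<in> X \<Longrightarrow> y \<in> Y \<Longrightarrow> g \<in> superdifferential (L x) y \<Longrightarrow> norm g \<le> G"
    and G_nonneg: "G \<ge> 0"
begin

abbreviation F :: "(real^'n) \<times> (real^'m) \<Rightarrow> ((real^'n) \<times> (real^'m)) set" where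
  "F \<equiv> natural_gradient_rhs X Y L Rx Ry"

abbreviation l :: "real^'n \<Rightarrow> real^'m \<Rightarrow> real" where
  "l x y \<equiv> real_of_ereal (L x y)"

lemma subdifferential_x_nonempty:
  "x \<in> X \<Longrightarrow> y \<in> Y \<Longrightarrow> subdifferential (\<lambda>x. L x y) x \<noteq> {}"
  using subgradients by blast

lemma subdifferential_y_nonempty:
  assumes "x \<in> X" "y \<in> Y"
  shows "subdifferential (\<lambda>y. - L x y) y \<noteq> {}"
proof -
  obtain g where "g \<in> superdifferential (L x) y" using subgradients assms by blast
  then have "- g \<in> subdifferential (\<lambda>y. - L x y) y"
    by (simp add: superdifferential_iff_subdifferential_uminus)
  then show ?thesis by blast
qed

lemma subgradient_bound_y:
  assumes "x \<in> X" "y \<in> Y" and g: "g \<in> subdifferential (\<lambda>y. - L x y) y"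
  shows "norm g \<le> G"
proof -
  have "- g \<in> superdifferential (L x) y"
    using g by (simp add: superdifferential_iff_subdifferential_uminus)
  from bound_y[OF assms(1,2) this] show ?thesis by simp
qed

lemma L_finite: "x \<in> X \<Longrightarrow> y \<in> Y \<Longrightarrow> \<bar>L x y\<bar> \<noteq> \<infinity>"
  by (rule subdifferential_bounded_imp_finite[OF subdifferential_x_nonempty bound_x])

lemma lipschitz_l_x: "y \<in> Y \<Longrightarrow> G-lipschitz_on X (\<lambda>x. l x y)"
  using subdifferential_x_nonempty bound_x G_nonneg
  by (intro subdifferential_bounded_imp_lipschitz) auto

lemma lipschitz_l_y:
  assumes "x \<in> X"
  shows "G-lipschitz_on Y (l x)"
proof -
  have "G-lipschitz_on Y (\<lambda>y. real_of_ereal (- L x y))"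
    using subdifferential_y_nonempty subgradient_bound_y G_nonneg assms
    by (intro subdifferential_bounded_imp_lipschitz) auto
  then show ?thesis by simp
qed

text \<open>Multiplying by the Hessians brings both players into the same form. The maximizing player is
  described by a subgradient \<open>h\<close> of \<open>- L x\<close>.\<close>

lemma F_velocityE:
  assumes "x \<in> X" "y \<in> Y" and "d \<in> F (x, y)"
  obtains g \<eta> h \<theta> where
    "g \<in> subdifferential (\<lambda>x. L x y) x" "\<eta> \<in> normal_cone X x"
    "hessian mx.r x *v fst d = - (g + \<eta>)"
    "h \<in> subdifferential (\<lambda>y. - L x y) y" "\<theta> \<in> normal_cone Y y"
    "hessian my.r y *v snd d = - (h + \<theta>)"
proof -
  from assms(3) obtain g \<eta> h \<theta> where d:
    "fst d = - (matrix_inv (hessian mx.r x) *v (g + \<eta>))"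
    "snd d = matrix_inv (hessian my.r y) *v (h - \<theta>)"
    and g: "g \<in> subdifferential (\<lambda>x. L x y) x" "\<eta> \<in> normal_cone X x"
      "h \<in> superdifferential (L x) y" "\<theta> \<in> normal_cone Y y"
    unfolding natural_gradient_rhs_def by auto
  have x: "x \<in> Ux" and y: "y \<in> Uy" using assms mx.X_subset_U my.X_subset_U by auto
  have "hessian mx.r x *v fst d = - (g + \<eta>)"
    unfolding d(1) using mx.hessian_matrix_inv[OF x, of "g + \<eta>"]
    by (simp add: linear_neg[OF matrix_vector_mul_linear])
  moreover have "hessian my.r y *v snd d = - (- h + \<theta>)"
    unfolding d(2) using my.hessian_matrix_inv[OF y, of "h - \<theta>"] by simp
  ultimately show thesis
    using g by (intro that[of g \<eta> "- h" \<theta>]) (auto simp: superdifferential_iff_subdifferential_uminus)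
qed

lemma saddle_point_zero_velocity:
  assumes s: "(p, q) \<in> saddle_points X Y L"
  shows "0 \<in> F (p, q)"
proof -
  from s have p: "p \<in> X" and q: "q \<in> Y"
    and min: "\<And>x. x \<in> X \<Longrightarrow> L p q \<le> L x q" and max: "\<And>y. y \<in> Y \<Longrightarrow> L p y \<le> L p q"
    by (auto simp: saddle_points_def)
  obtain g where g: "g \<in> subdifferential (\<lambda>x. L x q) p" "- g \<in> normal_cone X p"
    using constrained_minimum_imp_subgradient_normal[OF convex_L mx.convex_X p min
        subdifferential_x_nonempty[OF p q] bound_x[OF p q]] by blast
  have "ext_convex (\<lambda>y. - L p y)" using concave_L by (simp add: ext_concave_def)
  then obtain h where h: "h \<in> subdifferential (\<lambda>y. - L p y) q" "- h \<in> normal_cone Y q"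
    using constrained_minimum_imp_subgradient_normal[OF _ my.convex_X q _
        subdifferential_y_nonempty[OF p q] subgradient_bound_y[OF p q]] max by fastforce
  have "- h \<in> superdifferential (L p) q"
    using h by (simp add: superdifferential_iff_subdifferential_uminus)
  moreover have "0 = - (matrix_inv (hessian mx.r p) *v (g + - g))"
    "0 = matrix_inv (hessian my.r q) *v (- h - - h)" by simp_all
  ultimately have "0 \<in> {- (matrix_inv (hessian mx.r p) *v (g + \<eta>)) | g \<eta>.
        g \<in> subdifferential (\<lambda>x. L x q) p \<and> \<eta> \<in> normal_cone X p}"
    "0 \<in> {matrix_inv (hessian my.r q) *v (h - \<eta>) | h \<eta>.
        h \<in> superdifferential (L p) q \<and> \<eta> \<in> normal_cone Y q}"
    using g h by blast+
  then show ?thesis by (simp add: natural_gradient_rhs_def zero_prod_def)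
qed

definition lyapunov :: "(real^'n) \<times> (real^'m) \<Rightarrow> (real^'n) \<times> (real^'m) \<Rightarrow> real" where
  "lyapunov s w = mx.bregman (fst s) (fst w) + my.bregman (snd s) (snd w)"

text \<open>The negative of the usual primal-dual gap, so that it bounds the derivative of the Lyapunov
  function directly.\<close>

definition gap :: "(real^'n) \<times> (real^'m) \<Rightarrow> (real^'n) \<times> (real^'m) \<Rightarrow> real" where
  "gap s w = l (fst s) (snd w) - l (fst w) (snd s)"

lemma lyapunov_ge:
  assumes "s \<in> X \<times> Y" "w \<in> X \<times> Y"
  shows "\<sigma> / 2 * (norm (w - s))\<^sup>2 \<le> lyapunov s w"
proof -
  have U: "fst s \<in> Ux" "fst w \<in> Ux" "snd s \<in> Uy" "snd w \<in> Uy"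
    using assms mx.X_subset_U my.X_subset_U by auto
  have "\<sigma> / 2 * (norm (fst w - fst s))\<^sup>2 \<le> mx.bregman (fst s) (fst w)"
    "\<sigma> / 2 * (norm (snd w - snd s))\<^sup>2 \<le> my.bregman (snd s) (snd w)"
    using U by (intro mx.bregman_ge my.bregman_ge; simp)+
  moreover have "(norm (w - s))\<^sup>2 = (norm (fst w - fst s))\<^sup>2 + (norm (snd w - snd s))\<^sup>2"
    by (simp add: norm_prod_def)
  ultimately show ?thesis by (simp add: lyapunov_def distrib_left)
qed

lemma lyapunov_lipschitz:
  obtains C where "C-lipschitz_on (X \<times> Y) (lyapunov s)"
proof -
  obtain A where A: "A-lipschitz_on X (mx.bregman (fst s))" by (rule mx.bregman_lipschitz)
  obtain B where B: "B-lipschitz_on Y (my.bregman (snd s))" by (rule my.bregman_lipschitz)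
  have "A-lipschitz_on (fst ` (X \<times> Y)) (mx.bregman (fst s))"
    by (rule lipschitz_on_subset[OF A]) auto
  moreover have "B-lipschitz_on (snd ` (X \<times> Y)) (my.bregman (snd s))"
    by (rule lipschitz_on_subset[OF B]) auto
  moreover have "1-lipschitz_on (X \<times> Y) fst" "1-lipschitz_on (X \<times> Y) snd"
    by (rule lipschitz_onI; simp only: mult_1 dist_fst_le dist_snd_le zero_le_one)+
  ultimately have "(A * 1 + B * 1)-lipschitz_on (X \<times> Y)
      (\<lambda>w. mx.bregman (fst s) (fst w) + my.bregman (snd s) (snd w))"
    by (intro lipschitz_on_add lipschitz_on_compose2)
  then show thesis using that by (simp add: lyapunov_def[abs_def])
qed

lemma continuous_gap:
  assumes "s \<in> X \<times> Y"
  shows "continuous_on (X \<times> Y) (gap s)"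
proof -
  have "fst s \<in> X" "snd s \<in> Y" using assms by auto
  then have "continuous_on Y (l (fst s))" "continuous_on X (\<lambda>x. l x (snd s))"
    by (auto intro: lipschitz_on_continuous_on lipschitz_l_y lipschitz_l_x)
  then have "continuous_on (X \<times> Y) (\<lambda>w. l (fst s) (snd w))" "continuous_on (X \<times> Y) (\<lambda>w. l (fst w) (snd s))"
    by (auto intro: continuous_on_compose2[OF _ continuous_on_snd[OF continuous_on_id]]
        continuous_on_compose2[OF _ continuous_on_fst[OF continuous_on_id]])
  then show ?thesis unfolding gap_def[abs_def] by (rule continuous_on_diff)
qed

lemma gap_nonpos:
  assumes s: "s \<in> saddle_points X Y L" and w: "w \<in> X \<times> Y"
  shows "gap s w \<le> 0"
proof -
  obtain p q x y where eq: "s = (p, q)" "w = (x, y)" by (cases s; cases w) auto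
  with s w have mem: "p \<in> X" "q \<in> Y" "x \<in> X" "y \<in> Y" and le: "L p y \<le> L p q" "L p q \<le> L x q"
    by (auto simp: saddle_points_def)
  then have "L p y \<le> L x q" by order
  with L_finite[OF mem(1,4)] L_finite[OF mem(3,2)] have "l p y \<le> l x q"
    by (cases "L p y"; cases "L x q") auto
  then show ?thesis by (simp add: gap_def eq)
qed

lemma gap_neg:
  assumes s: "s \<in> saddle_points X Y L" and w: "w \<in> X \<times> Y"
    and strict: "L (fst s) (snd w) < L (fst s) (snd s) \<or> L (fst s) (snd s) < L (fst w) (snd s)"
  shows "gap s w < 0"
proof -
  obtain p q x y where eq: "s = (p, q)" "w = (x, y)" by (cases s; cases w) auto
  with s w have mem: "p \<in> X" "q \<in> Y" "x \<in> X" "y \<in> Y" and le: "L p y \<le> L p q" "L p q \<le> L x q"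
    by (auto simp: saddle_points_def)
  have "L p y < L x q" using le strict by (auto simp: eq)
  with L_finite[OF mem(1,4)] L_finite[OF mem(3,2)] have "l p y < l x q"
    by (cases "L p y"; cases "L x q") auto
  then show ?thesis by (simp add: gap_def eq)
qed

text \<open>The two players contribute \<open>l p y - l x y\<close> and \<open>l x y - l x q\<close>; their sum is the gap.\<close>

lemma lyapunov_derivative_le_gap:
  assumes z: "(z has_vector_derivative d) (at t)" and zt: "z t \<in> X \<times> Y" and d: "d \<in> F (z t)"
    and s: "s \<in> X \<times> Y"
  shows "\<exists>D\<le>gap s (z t). ((\<lambda>t. lyapunov s (z t)) has_vector_derivative D) (at t)"
proof -
  obtain x y where xy: "z t = (x, y)" by (cases "z t")
  obtain p q where pq: "s = (p, q)" by (cases s)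
  have mem: "x \<in> X" "y \<in> Y" "p \<in> X" "q \<in> Y" using zt s by (auto simp: xy pq)
  have U: "x \<in> Ux" "y \<in> Uy" using mem mx.X_subset_U my.X_subset_U by auto
  from F_velocityE[OF mem(1,2) d[unfolded xy]] obtain g \<eta> h \<theta> where
    g: "g \<in> subdifferential (\<lambda>x. L x y) x" "\<eta> \<in> normal_cone X x"
      "hessian mx.r x *v fst d = - (g + \<eta>)" and
    h: "h \<in> subdifferential (\<lambda>y. - L x y) y" "\<theta> \<in> normal_cone Y y"
      "hessian my.r y *v snd d = - (h + \<theta>)" .
  have "((\<lambda>t. fst (z t)) has_vector_derivative fst d) (at t)"
    "((\<lambda>t. snd (z t)) has_vector_derivative snd d) (at t)"
    using z by (auto intro: bounded_linear.has_vector_derivative bounded_linear_fst bounded_linear_snd)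
  then have "((\<lambda>t. lyapunov s (z t)) has_vector_derivative
      - ((hessian mx.r x *v fst d) \<bullet> (p - x)) + - ((hessian my.r y *v snd d) \<bullet> (q - y))) (at t)"
    using mx.has_vector_derivative_bregman[of "\<lambda>t. fst (z t)" "fst d" t p]
      my.has_vector_derivative_bregman[of "\<lambda>t. snd (z t)" "snd d" t q] U
    unfolding lyapunov_def by (intro has_vector_derivative_add) (simp_all add: xy pq)
  moreover have "- ((hessian mx.r x *v fst d) \<bullet> (p - x)) \<le> l p y - l x y"
    by (rule mx.bregman_decrease[OF mem(1,3) g(3,1,2)]) (use L_finite mem in auto)
  moreover have "- ((hessian my.r y *v snd d) \<bullet> (q - y)) \<le> real_of_ereal (- L x q) - real_of_ereal (- L x y)"
    by (rule my.bregman_decrease[OF mem(2,4) h(3,1,2)]) (use L_finite mem in auto)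
  ultimately show ?thesis by (intro exI conjI) (auto simp: gap_def xy pq)
qed

text \<open>The right-hand side of the inclusion is unbounded where the normal cones are nontrivial. Viability
  is what bounds the velocity: it forces the normal terms to be orthogonal to it.\<close>

lemma velocity_norm_le:
  assumes zC: "\<And>t. t \<ge> 0 \<Longrightarrow> z t \<in> X \<times> Y" and t: "t > 0"
    and z: "(z has_vector_derivative d) (at t)" and d: "d \<in> F (z t)"
  shows "norm d \<le> 2 * G / \<sigma>"
proof -
  have mem: "fst (z t) \<in> X" "snd (z t) \<in> Y" using zC[of t] t by auto
  have "d \<in> F (fst (z t), snd (z t))" using d by simp
  from F_velocityE[OF mem this] obtain g \<eta> h \<theta> where
    g: "g \<in> subdifferential (\<lambda>x. L x (snd (z t))) (fst (z t))" "\<eta> \<in> normal_cone X (fst (z t))"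
      "hessian mx.r (fst (z t)) *v fst d = - (g + \<eta>)" and
    h: "h \<in> subdifferential (\<lambda>y. - L (fst (z t)) y) (snd (z t))" "\<theta> \<in> normal_cone Y (snd (z t))"
      "hessian my.r (snd (z t)) *v snd d = - (h + \<theta>)" .
  have z': "((\<lambda>t. fst (z t)) has_vector_derivative fst d) (at t)"
    "((\<lambda>t. snd (z t)) has_vector_derivative snd d) (at t)"
    using z by (auto intro: bounded_linear.has_vector_derivative bounded_linear_fst bounded_linear_snd)
  have "\<eta> \<bullet> fst d = 0"
    by (rule normal_orthogonal_viable_velocity[OF t _ z'(1) g(2)]) (use zC in \<open>auto simp: mem_Times_iff\<close>)
  then have "norm (fst d) \<le> G / \<sigma>"
    by (rule mx.velocity_bound[OF mem(1) g(3) bound_x[OF mem g(1)]])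
  moreover have "\<theta> \<bullet> snd d = 0"
    by (rule normal_orthogonal_viable_velocity[OF t _ z'(2) h(2)]) (use zC in \<open>auto simp: mem_Times_iff\<close>)
  then have "norm (snd d) \<le> G / \<sigma>"
    by (rule my.velocity_bound[OF mem(2) h(3) subgradient_bound_y[OF mem h(1)]])
  ultimately show ?thesis using norm_Pair_le[of "fst d" "snd d"] by simp
qed

context
  fixes z z0
  assumes solution: "viable_caratheodory_solution F (X \<times> Y) z0 z"
begin

lemma solution_viable: "t \<ge> 0 \<Longrightarrow> z t \<in> X \<times> Y"
  using solution by (simp add: viable_caratheodory_solution_def)

lemma solution_abs_continuous:
  assumes "a \<ge> 0"
  shows "abs_continuous_on {a..b} z"
proof -
  have "abs_continuous_on {0..max 0 b} z"
    using solution by (simp add: viable_caratheodory_solution_def)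
  then show ?thesis by (rule abs_continuous_on_subset) (use assms in auto)
qed

lemma solution_lipschitz: "(2 * G / \<sigma>)-lipschitz_on {0..} z"
proof -
  obtain N where N: "negligible N"
    "\<And>t. t > 0 \<Longrightarrow> t \<notin> N \<Longrightarrow> \<exists>v\<in>F (z t). (z has_vector_derivative v) (at t)"
    using viable_caratheodory_solution_derivative[OF solution] by blast
  have le: "norm (z b - z a) \<le> 2 * G / \<sigma> * (b - a)" if "0 \<le> a" "a \<le> b" for a b
  proof (rule abs_continuous_increment_norm_le)
    show "negligible (insert 0 N)" using N(1) by simp
    fix t assume "t \<in> {a..b} - insert 0 N"
    with that have t: "t > 0" "t \<notin> N" by auto
    from N(2)[OF this] obtain v where v: "v \<in> F (z t)" "(z has_vector_derivative v) (at t)" by blast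
    show "\<exists>v. norm v \<le> 2 * G / \<sigma> \<and> (z has_vector_derivative v) (at t within {a..b})"
      using velocity_norm_le[OF solution_viable t(1) v(2,1)]
        has_vector_derivative_at_within[OF v(2)] by blast
  qed (use that solution_abs_continuous in auto)
  show ?thesis
  proof (rule lipschitz_onI)
    fix a b :: real assume "a \<in> {0..}" "b \<in> {0..}"
    then show "dist (z a) (z b) \<le> 2 * G / \<sigma> * dist a b"
      using le[of a b] le[of b a] by (cases "a \<le> b") (auto simp: dist_norm norm_minus_commute)
  qed (use G_nonneg mx.\<sigma>_pos in simp)
qed

lemma lyapunov_increment_le:
  assumes s: "s \<in> X \<times> Y" and ab: "0 \<le> a" "a \<le> b"
    and gap: "\<And>t. t \<in> {a..b} \<Longrightarrow> gap s (z t) \<le> c"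
  shows "lyapunov s (z b) - lyapunov s (z a) \<le> c * (b - a)"
proof -
  obtain N where N: "negligible N"
    "\<And>t. t > 0 \<Longrightarrow> t \<notin> N \<Longrightarrow> \<exists>v\<in>F (z t). (z has_vector_derivative v) (at t)"
    using viable_caratheodory_solution_derivative[OF solution] by blast
  show ?thesis
  proof (rule abs_continuous_increment_le[OF ab(2)])
    obtain C where C: "C-lipschitz_on (X \<times> Y) (lyapunov s)" by (rule lyapunov_lipschitz)
    show "abs_continuous_on {a..b} (\<lambda>t. lyapunov s (z t))"
      by (rule abs_continuous_on_lipschitz_compose[OF solution_abs_continuous[OF ab(1)] C])
        (intro image_subsetI solution_viable, use ab(1) in auto)
    show "negligible (insert 0 N)" using N(1) by simp
    fix t assume "t \<in> {a..b} - insert 0 N"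
    with ab(1) have t: "t > 0" "t \<notin> N" "t \<in> {a..b}" by auto
    from N(2)[OF t(1,2)] obtain v where v: "v \<in> F (z t)" "(z has_vector_derivative v) (at t)" by blast
    have "z t \<in> X \<times> Y" using t(1) by (intro solution_viable) simp
    from lyapunov_derivative_le_gap[OF v(2) this v(1) s] obtain D where D: "D \<le> gap s (z t)"
      "((\<lambda>t. lyapunov s (z t)) has_vector_derivative D) (at t)" by blast
    show "\<exists>D\<le>c. ((\<lambda>t. lyapunov s (z t)) has_vector_derivative D) (at t within {a..b})"
      using order_trans[OF D(1) gap[OF t(3)]] has_vector_derivative_at_within[OF D(2)] by blast
  qed
qed

text \<open>The Lyapunov functions of all saddle points are used together, as each of them may be
  stationary at some points that are not saddle points.\<close>

lemma solution_converges:
  assumes strict: "\<And>x y. (x, y) \<in> X \<times> Y - saddle_points X Y L \<Longrightarrow>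
    \<exists>(p, q)\<in>saddle_points X Y L. L p y < L p q \<or> L p q < L x q"
  shows "((\<lambda>t. infdist (z t) (saddle_points X Y L)) \<longlongrightarrow> 0) at_top"
proof (rule dissipation_imp_convergence)
  have sub: "s \<in> X \<times> Y" if "s \<in> saddle_points X Y L" for s
    using that by (auto simp: saddle_points_def)
  show "compact (X \<times> Y)" by (intro compact_Times mx.compact_X my.compact_X)
  show "(2 * G / \<sigma>)-lipschitz_on {0..} z" by (rule solution_lipschitz)
  show "continuous_on (X \<times> Y) (gap s)" if "s \<in> saddle_points X Y L" for s
    using that by (intro continuous_gap sub)
  show "lyapunov s (z t) \<ge> 0" if "s \<in> saddle_points X Y L" "t \<ge> 0" for s t
  proof -
    have "0 \<le> \<sigma> / 2 * (norm (z t - s))\<^sup>2" using mx.\<sigma>_pos by simp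
    also have "\<dots> \<le> lyapunov s (z t)" using that by (intro lyapunov_ge sub solution_viable)
    finally show ?thesis .
  qed
  show "lyapunov s (z b) - lyapunov s (z a) \<le> c * (b - a)"
    if "s \<in> saddle_points X Y L" "0 \<le> a" "a \<le> b" "\<And>t. t \<in> {a..b} \<Longrightarrow> gap s (z t) \<le> c" for s a b c
    using that by (intro lyapunov_increment_le sub)
  show "\<exists>s\<in>saddle_points X Y L. gap s w < 0" if w: "w \<in> X \<times> Y - saddle_points X Y L" for w
  proof -
    obtain x y where xy: "w = (x, y)" by (cases w)
    from strict[of x y] w obtain p q where pq: "(p, q) \<in> saddle_points X Y L"
      "L p y < L p q \<or> L p q < L x q" by (auto simp: xy)
    then have "gap (p, q) w < 0" using w by (intro gap_neg) (auto simp: xy)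
    with pq(1) show ?thesis by blast
  qed
qed (auto intro: solution_viable gap_nonpos)

end

text \<open>The Lyapunov function grows at most linearly and at least quadratically with the distance to
  \<open>s\<close>, which gives \<open>\<delta>\<close> of order \<open>\<epsilon>\<^sup>2\<close>.\<close>

lemma saddle_point_lyapunov_stable:
  assumes s: "s \<in> saddle_points X Y L"
  shows "lyapunov_stable_equilibrium F (X \<times> Y) s"
proof -
  have sC: "s \<in> X \<times> Y" using s by (auto simp: saddle_points_def)
  have "equilibrium_point F (X \<times> Y) s"
    using s sC saddle_point_zero_velocity by (cases s) (auto simp: equilibrium_point_def)
  moreover have "\<exists>\<delta>>0. \<forall>z0\<in>X \<times> Y. \<forall>z. viable_caratheodory_solution F (X \<times> Y) z0 z \<and>
      norm (z0 - s) < \<delta> \<longrightarrow> (\<forall>t\<ge>0. norm (z t - s) < \<epsilon>)" if \<epsilon>: "\<epsilon> > 0" for \<epsilon>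
  proof -
    obtain C where C: "C-lipschitz_on (X \<times> Y) (lyapunov s)" by (rule lyapunov_lipschitz)
    then have C0: "C \<ge> 0" by (rule lipschitz_on_nonneg)
    then have C1: "(C + 1) * (K / (C + 1)) = K" for K :: real by simp
    define \<delta> where "\<delta> = \<sigma> / 2 * \<epsilon>\<^sup>2 / (C + 1)"
    have "\<delta> > 0" using C0 \<epsilon> mx.\<sigma>_pos by (simp add: \<delta>_def)
    moreover have "norm (z t - s) < \<epsilon>"
      if z0: "z0 \<in> X \<times> Y" and z: "viable_caratheodory_solution F (X \<times> Y) z0 z"
        and close: "norm (z0 - s) < \<delta>" and t: "t \<ge> 0" for z0 z t
    proof -
      have z0_eq: "z 0 = z0" using z by (simp add: viable_caratheodory_solution_def)
      have "lyapunov s (z t) - lyapunov s (z 0) \<le> 0 * (t - 0)"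
        using s sC t by (intro lyapunov_increment_le[OF z] gap_nonpos solution_viable[OF z]) auto
      moreover have "lyapunov s s = 0" by (simp add: lyapunov_def)
      moreover have "dist (lyapunov s z0) (lyapunov s s) \<le> C * dist z0 s"
        by (rule lipschitz_onD[OF C z0 sC])
      ultimately have "lyapunov s (z t) \<le> C * norm (z0 - s)"
        by (simp add: z0_eq dist_real_def dist_norm)
      also have "\<dots> \<le> (C + 1) * norm (z0 - s)" by (simp add: mult_right_mono)
      also have "\<dots> < (C + 1) * \<delta>" using close C0 by simp
      also have "\<dots> = \<sigma> / 2 * \<epsilon>\<^sup>2" unfolding \<delta>_def by (rule C1)
      finally have "\<sigma> / 2 * (norm (z t - s))\<^sup>2 < \<sigma> / 2 * \<epsilon>\<^sup>2"
        using lyapunov_ge[OF sC solution_viable[OF z t]] by simp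
      then have "(norm (z t - s))\<^sup>2 < \<epsilon>\<^sup>2" using mx.\<sigma>_pos by simp
      then show ?thesis using \<epsilon> by (simp add: power2_less_imp_less)
    qed
    ultimately show ?thesis by blast
  qed
  ultimately show ?thesis by (simp add: lyapunov_stable_equilibrium_def)
qed

end


section \<open>Stability of saddle points and convergence to them\<close>

theorem theorem2:
  fixes X :: "(real^'n) set" and Y :: "(real^'m) set"
    and L :: "real^'n \<Rightarrow> real^'m \<Rightarrow> ereal"
    and Rx :: "real^'n \<Rightarrow> ereal" and R\<gamma> :: "real^'m \<Rightarrow> ereal"
    and Ux :: "(real^'n) set" and U\<gamma> :: "(real^'m) set"
    and \<sigma>\<^sub>R G :: real
    and S :: "((real^'n) \<times> (real^'m)) set"
    and F :: "(real^'n) \<times> (real^'m) \<Rightarrow> ((real^'n) \<times> (real^'m)) set"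
  defines "S \<equiv> saddle_points X Y L"
    and "F \<equiv> natural_gradient_rhs X Y L Rx R\<gamma>"
  assumes X: "X \<noteq> {}" "convex X" "compact X"
    and Y: "Y \<noteq> {}" "convex Y" "compact Y"
    and convex_L: "\<And>\<gamma>. ext_convex (\<lambda>x. L x \<gamma>)"
    and concave_L: "\<And>x. ext_concave (\<lambda>\<gamma>. L x \<gamma>)"
    and A1_S: "S \<noteq> {}" "compact S"
    and A1_strict: "\<And>x \<gamma>. (x, \<gamma>) \<in> (X \<times> Y) - S \<Longrightarrow>
          \<exists>(x', \<gamma>')\<in>S. L x' \<gamma> < L x' \<gamma>' \<or> L x' \<gamma>' < L x \<gamma>'"
    and A2_usc: "\<And>x. x \<in> X \<Longrightarrow> upper_semicontinuous (\<lambda>\<gamma>. L x \<gamma>)"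
    and A2_lsc: "\<And>\<gamma>. \<gamma> \<in> Y \<Longrightarrow> lower_semicontinuous (\<lambda>x. L x \<gamma>)"
    and A3_nonempty: "\<And>x \<gamma>. x \<in> X \<Longrightarrow> \<gamma> \<in> Y \<Longrightarrow>
          subdifferential (\<lambda>y. L y \<gamma>) x \<times> superdifferential (L x) \<gamma> \<noteq> {}"
    and A3_G: "G > 0"
    and A3_bound_x: "\<And>x \<gamma> g. x \<in> X \<Longrightarrow> \<gamma> \<in> Y \<Longrightarrow>
          g \<in> subdifferential (\<lambda>y. L y \<gamma>) x \<Longrightarrow> norm g \<le> G"
    and A3_bound_\<gamma>: "\<And>x \<gamma> g. x \<in> X \<Longrightarrow> \<gamma> \<in> Y \<Longrightarrow>
          g \<in> superdifferential (L x) \<gamma> \<Longrightarrow> norm g \<le> G"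
    and \<sigma>\<^sub>R: "\<sigma>\<^sub>R > 0"
    and Rx: "open Ux" "X \<subseteq> Ux" "ext_C2_on Ux Rx" "ext_strongly_convex_on Ux \<sigma>\<^sub>R Rx"
    and R\<gamma>: "open U\<gamma>" "Y \<subseteq> U\<gamma>" "ext_C2_on U\<gamma> R\<gamma>" "ext_strongly_convex_on U\<gamma> \<sigma>\<^sub>R R\<gamma>"
  shows "(\<forall>(x', \<gamma>')\<in>S. lyapunov_stable_equilibrium F (X \<times> Y) (x', \<gamma>')) \<and>
    (\<forall>x0\<in>X. \<forall>\<gamma>0\<in>Y. \<forall>z. viable_caratheodory_solution F (X \<times> Y) (x0, \<gamma>0) z \<longrightarrow>
       ((\<lambda>t. infdist (z t) S) \<longlongrightarrow> 0) at_top)"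
proof -
  have G: "G \<ge> 0" using A3_G by simp
  interpret saddle_flow X Y Ux U\<gamma> Rx R\<gamma> \<sigma>\<^sub>R L G
    by unfold_locales (fact X Y Rx R\<gamma> \<sigma>\<^sub>R convex_L concave_L A3_nonempty A3_bound_x A3_bound_\<gamma> G)+
  have "lyapunov_stable_equilibrium F (X \<times> Y) s" if "s \<in> S" for s
    using saddle_point_lyapunov_stable[of s] that by (simp add: S_def F_def)
  moreover have "((\<lambda>t. infdist (z t) S) \<longlongrightarrow> 0) at_top"
    if "viable_caratheodory_solution F (X \<times> Y) z0 z" for z z0
    unfolding S_def
    by (rule solution_converges[OF that[unfolded F_def]]) (use A1_strict in \<open>auto simp: S_def\<close>)
  ultimately show ?thesis by auto
qed

end
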